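(* Let $\alpha\in(1,2)$. Then there exist $\rho>0$, a continuous function $a:\overline{B_\rho(0)}\to(0,+\infty)$, where $B_\rho(0)\subset\mathbb R^4$, and a function $w>0$ in $B_\rho(0)\setminus\{0\}$ with $w\in C^\infty(\overline{B_\rho(0)}\setminus\{0\})\cap W^{3,p}(B_\rho(0))$ for any $1<p<\frac43$ and $\Delta^2w\in L^1(B_\rho(0))$, such that $w$ is a distributional solution of $$\Delta^2w=a(x)e^{w^\alpha}\ \text{ in }B_\rho(0),\qquad w=\partial_nw=0\ \text{ on }\partial B_\rho(0),$$ but $w\notin L^\infty(B_\rho(0))$.
   Context: $B_\rho(0)$ is the open ball of radius $\rho$ centred at the origin in $\mathbb R^4$; $n$ is the outer unit normal. Distributional solution means that $a\,e^{w^\alpha}\in L^1(B_\rho(0))$ and the equation holds in the sense of distributions in the whole ball $B_\rho(0)$ (including the origin); the boundary conditions hold pointwise, $w$ being smooth up to the boundary away from the origin. *)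

theory Defs
  imports "HOL-Analysis.Analysis"
begin

definition partial_deriv :: "'a::euclidean_space \<Rightarrow> ('a \<Rightarrow> real) \<Rightarrow> 'a \<Rightarrow> real" where
  "partial_deriv b f x = frechet_derivative f (at x) b"

text \<open>A multi-index is encoded as the list of basis vectors along which one differentiates.\<close>

fun partial_derivs :: "'a::euclidean_space list \<Rightarrow> ('a \<Rightarrow> real) \<Rightarrow> 'a \<Rightarrow> real" where
  "partial_derivs [] f = f"
| "partial_derivs (b # bs) f = partial_deriv b (partial_derivs bs f)"

definition laplacian :: "('a::euclidean_space \<Rightarrow> real) \<Rightarrow> 'a \<Rightarrow> real" where
  "laplacian f x = (\<Sum>b\<in>Basis. partial_deriv b (partial_deriv b f) x)"

definition bilaplacian :: "('a::euclidean_space \<Rightarrow> real) \<Rightarrow> 'a \<Rightarrow> real" where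
  "bilaplacian f = laplacian (laplacian f)"

text \<open>The next two definitions are meant for open \<open>U\<close>.\<close>

fun Ck_on :: "nat \<Rightarrow> 'a::euclidean_space set \<Rightarrow> ('a \<Rightarrow> real) \<Rightarrow> bool" where
  "Ck_on 0 U f \<longleftrightarrow> continuous_on U f"
| "Ck_on (Suc k) U f \<longleftrightarrow>
     (\<forall>x\<in>U. f differentiable (at x)) \<and> (\<forall>b\<in>Basis. Ck_on k U (partial_deriv b f))"

definition smooth_on :: "'a::euclidean_space set \<Rightarrow> ('a \<Rightarrow> real) \<Rightarrow> bool" where
  "smooth_on U f \<longleftrightarrow> (\<forall>k. Ck_on k U f)"

text \<open>Smoothness on a set \<open>S\<close> that need not be open: \<open>f\<close> is on \<open>S\<close> the restriction of a smooth
  function defined near \<open>S\<close>. This expresses smoothness up to the part of the boundary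
  contained in \<open>S\<close>; values of \<open>f\<close> outside \<open>S\<close> do not matter.\<close>

definition smooth_up_to :: "'a::euclidean_space set \<Rightarrow> ('a \<Rightarrow> real) \<Rightarrow> bool" where
  "smooth_up_to S f \<longleftrightarrow>
     (\<exists>V g. open V \<and> S \<subseteq> V \<and> smooth_on V g \<and> (\<forall>x\<in>S. g x = f x))"

definition test_function :: "'a::euclidean_space set \<Rightarrow> ('a \<Rightarrow> real) \<Rightarrow> bool" where
  "test_function U \<phi> \<longleftrightarrow>
     smooth_on UNIV \<phi> \<and> compact (closure {x. \<phi> x \<noteq> 0}) \<and> closure {x. \<phi> x \<noteq> 0} \<subseteq> U"

definition locally_integrable :: "'a::euclidean_space set \<Rightarrow> ('a \<Rightarrow> real) \<Rightarrow> bool" where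
  "locally_integrable U f \<longleftrightarrow>
     (\<forall>K. compact K \<and> K \<subseteq> U \<longrightarrow> integrable (lebesgue_on K) f)"

definition in_Lp :: "real \<Rightarrow> 'a::euclidean_space set \<Rightarrow> ('a \<Rightarrow> real) \<Rightarrow> bool" where
  "in_Lp p U f \<longleftrightarrow>
     f \<in> borel_measurable (lebesgue_on U) \<and> integrable (lebesgue_on U) (\<lambda>x. \<bar>f x\<bar> powr p)"

definition in_Linfty :: "'a::euclidean_space set \<Rightarrow> ('a \<Rightarrow> real) \<Rightarrow> bool" where
  "in_Linfty U f \<longleftrightarrow>
     f \<in> borel_measurable (lebesgue_on U) \<and> (\<exists>C. AE x in lebesgue_on U. \<bar>f x\<bar> \<le> C)"

definition has_weak_partial_derivs ::
    "('a::euclidean_space \<Rightarrow> real) \<Rightarrow> 'a list \<Rightarrow> ('a \<Rightarrow> real) \<Rightarrow> 'a set \<Rightarrow> bool" where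
  "has_weak_partial_derivs u bs g U \<longleftrightarrow>
     locally_integrable U u \<and> locally_integrable U g \<and>
     (\<forall>\<phi>. test_function U \<phi> \<longrightarrow>
        (LINT x|lebesgue_on U. u x * partial_derivs bs \<phi> x) =
        (-1) ^ length bs * (LINT x|lebesgue_on U. g x * \<phi> x))"

definition in_Sobolev :: "nat \<Rightarrow> real \<Rightarrow> 'a::euclidean_space set \<Rightarrow> ('a \<Rightarrow> real) \<Rightarrow> bool" where
  "in_Sobolev k p U u \<longleftrightarrow> in_Lp p U u \<and>
     (\<forall>bs. set bs \<subseteq> Basis \<and> length bs \<le> k \<longrightarrow>
        (\<exists>g. in_Lp p U g \<and> has_weak_partial_derivs u bs g U))"

definition has_distributional_bilaplacian ::
    "('a::euclidean_space \<Rightarrow> real) \<Rightarrow> ('a \<Rightarrow> real) \<Rightarrow> 'a set \<Rightarrow> bool" where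
  "has_distributional_bilaplacian u f U \<longleftrightarrow>
     locally_integrable U u \<and> locally_integrable U f \<and>
     (\<forall>\<phi>. test_function U \<phi> \<longrightarrow>
        (LINT x|lebesgue_on U. u x * bilaplacian \<phi> x) = (LINT x|lebesgue_on U. f x * \<phi> x))"

text \<open>Derivative of \<open>f\<close> at a boundary point \<open>x\<close> of \<open>S\<close> in direction \<open>n\<close>, using only the values
  of \<open>f\<close> on \<open>S\<close>.\<close>

definition has_normal_derivative ::
    "('a::euclidean_space \<Rightarrow> real) \<Rightarrow> real \<Rightarrow> 'a set \<Rightarrow> 'a \<Rightarrow> 'a \<Rightarrow> bool" where
  "has_normal_derivative f d S n x \<longleftrightarrow>
     (\<exists>D. (f has_derivative D) (at x within S) \<and> D n = d)"

end

theory Submission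
  imports Defs "HOL-Real_Asymp.Real_Asymp"
begin

text \<open>Put \<open>\<gamma> = 1/\<alpha>\<close> and \<open>t = - ln |x|\<close>. For \<open>w = f(t)\<close> in dimension 4 one has
  \<open>\<Delta>\<^sup>2 w = |x|\<^bsup>-4\<^esup> (f'''' - 4 f'')\<close>. If \<open>f\<close> is asymptotic to \<open>(4 t - (2 - \<gamma>) ln t)\<^bsup>\<gamma>\<^esup>\<close> to
  sufficient order, then \<open>exp (w\<^bsup>\<alpha>\<^esup>)\<close> and \<open>\<Delta>\<^sup>2 w\<close> are both comparable to \<open>|x|\<^bsup>-4\<^esup> t\<^bsup>\<gamma> - 2\<^esup>\<close>, which is
  integrable because \<open>\<gamma> < 1\<close>, and their quotient \<open>a\<close> extends continuously to the origin with a
  positive value. Adding \<open>- M |x| + C |x|\<^sup>2\<close> achieves the Dirichlet conditions on the unit sphere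
  without destroying positivity or the asymptotics.

  The equation holds across the origin because the origin does not contribute to the integrations
  by parts: cutting off at scale \<open>\<epsilon>\<close>, the boundary terms are \<open>o(1)\<close> as soon as the vector field is
  \<open>o(|x|\<^bsup>-3\<^esup>)\<close>, and the most singular field \<open>\<nabla>\<Delta>w\<close> is of order \<open>|x|\<^bsup>-3\<^esup> t\<^bsup>\<gamma> - 1\<^esup>\<close>.\<close>

section \<open>Calculus of \<open>C\<^sup>k\<close> functions\<close>

text \<open>For \<open>w = f(t)\<close> the equation reads
  \<open>f'''' - 4 f'' = a exp (f^\<alpha> - 4 t)\<close>. The leading term
  \<open>(4 t)^\<gamma>\<close> is concave, so the left side is asymptotic to a positive multiple of
  \<open>t^(\<gamma> - 2)\<close>. Matching this with the exponential forces
  \<open>f^\<alpha> = 4 t - (2 - \<gamma>) ln t + O(1)\<close>, which fixes both constants; the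
  coefficient absorbs the bounded rest, and it is continuous at the origin once that rest converges.
  The obstacle is the origin. In dimension 4 the function \<open>ln (1/|x|)\<close> is a multiple of
  the fundamental solution of the bilaplacian: the gradient of its Laplacian has exact order
  \<open>|x|^(-3)\<close> and leaves a Dirac mass. Removability therefore rests on \<open>f\<close>
  growing more slowly than \<open>t\<close>, used in the form \<open>f' -> 0\<close> and
  \<open>f''' -> 0\<close>. Everywhere else size bounds are enough: derivatives up to order 3 are at
  most a multiple of \<open>|x|^(-3)\<close>, whose \<open>p\<close>-th power is integrable for
  \<open>3 p < 4\<close>, which is the Sobolev range.\<close>

lemma partial_deriv_eq:
  "(f has_derivative D) (at x) \<Longrightarrow> partial_deriv b f x = D b"
  unfolding partial_deriv_def using frechet_derivative_at by metis

text \<open>\<open>frechet_derivative\<close> is a choice among all derivatives at a point.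
  Functions that agree near the point have the same derivatives, so the choices coincide even where
  neither function is differentiable.\<close>

lemma partial_deriv_cong:
  assumes "open U" "x \<in> U" "\<And>y. y \<in> U \<Longrightarrow> f y = g y"
  shows "partial_deriv b f x = partial_deriv b g x"
proof -
  have "(f has_derivative D) (at x) \<longleftrightarrow> (g has_derivative D) (at x)" for D
    using has_derivative_transform_within_open[OF _ assms(1,2)] assms(3) by metis
  then show ?thesis
    unfolding partial_deriv_def frechet_derivative_def by simp
qed

lemma differentiable_cong_open:
  assumes "open U" "x \<in> U" "\<And>y. y \<in> U \<Longrightarrow> f y = g y"
  shows "f differentiable (at x) \<longleftrightarrow> g differentiable (at x)"
  unfolding differentiable_def
  using has_derivative_transform_within_open[OF _ assms(1,2)] assms(3) by metis

lemma Ck_on_cong: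
  assumes "open U" "\<And>y. y \<in> U \<Longrightarrow> f y = g y"
  shows "Ck_on k U f \<longleftrightarrow> Ck_on k U g"
  using assms(2)
proof (induction k arbitrary: f g)
  case 0
  then show ?case by (auto intro: continuous_on_cong)
next
  case (Suc k)
  have "f differentiable (at x) \<longleftrightarrow> g differentiable (at x)" if "x \<in> U" for x
    using differentiable_cong_open[OF assms(1) that] Suc.prems by blast
  moreover have "Ck_on k U (partial_deriv b f) \<longleftrightarrow> Ck_on k U (partial_deriv b g)" for b
    by (rule Suc.IH) (rule partial_deriv_cong[OF assms(1)], auto simp: Suc.prems)
  ultimately show ?case by simp
qed

lemma Ck_on_continuous_on: "Ck_on k U f \<Longrightarrow> continuous_on U f"
  by (cases k) (auto intro!: continuous_at_imp_continuous_on differentiable_imp_continuous_within)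

lemma Ck_on_Suc_imp: "Ck_on (Suc k) U f \<Longrightarrow> Ck_on k U f"
proof (induction k arbitrary: f)
  case 0
  then show ?case using Ck_on_continuous_on[OF 0] by simp
next
  case (Suc k)
  then show ?case by (auto simp del: Ck_on.simps(2) simp: Ck_on.simps(2)[of "Suc k"] Ck_on.simps(2)[of k])
qed

lemma Ck_on_subset: "Ck_on k U f \<Longrightarrow> T \<subseteq> U \<Longrightarrow> Ck_on k T f"
  by (induction k arbitrary: f) (auto intro: continuous_on_subset)

lemma partial_deriv_const [simp]: "partial_deriv b (\<lambda>x. c) = (\<lambda>x. 0)"
  by (rule ext, subst partial_deriv_eq[where D = "\<lambda>h. 0"]) auto

lemma Ck_on_const [simp]: "Ck_on k U (\<lambda>x. c)"
  by (induction k arbitrary: c) auto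

lemma partial_deriv_add:
  assumes "f differentiable (at x)" "g differentiable (at x)"
  shows "partial_deriv b (\<lambda>x. f x + g x) x = partial_deriv b f x + partial_deriv b g x"
  using partial_deriv_eq[OF has_derivative_add[OF assms[unfolded frechet_derivative_works]]]
  by (simp add: partial_deriv_def)

lemma partial_deriv_mult:
  assumes "f differentiable (at x)" "g differentiable (at x)"
  shows "partial_deriv b (\<lambda>x. f x * g x) x = f x * partial_deriv b g x + partial_deriv b f x * g x"
  using partial_deriv_eq[OF has_derivative_mult[OF assms[unfolded frechet_derivative_works]]]
  by (simp add: partial_deriv_def)

lemma Ck_on_add:
  assumes "open U" "Ck_on k U f" "Ck_on k U g"
  shows "Ck_on k U (\<lambda>x. f x + g x)"
  using assms(2,3)
proof (induction k arbitrary: f g)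
  case 0
  then show ?case by (auto intro: continuous_on_add)
next
  case (Suc k)
  have "Ck_on k U (partial_deriv b (\<lambda>x. f x + g x))" if "b \<in> Basis" for b
  proof (subst Ck_on_cong[OF assms(1)])
    show "partial_deriv b (\<lambda>x. f x + g x) x = partial_deriv b f x + partial_deriv b g x"
      if "x \<in> U" for x
      using Suc.prems that by (auto intro!: partial_deriv_add)
    show "Ck_on k U (\<lambda>x. partial_deriv b f x + partial_deriv b g x)"
      using Suc.prems that by (intro Suc.IH) auto
  qed
  then show ?case using Suc.prems by (auto intro: differentiable_add)
qed

lemma Ck_on_sum:
  assumes "open U" "finite A" "\<And>i. i \<in> A \<Longrightarrow> Ck_on k U (f i)"
  shows "Ck_on k U (\<lambda>x. \<Sum>i\<in>A. f i x)"
  using assms(2,3)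
proof (induction A rule: finite_induct)
  case (insert i A)
  then show ?case using Ck_on_add[OF assms(1), of k "f i" "\<lambda>x. \<Sum>i\<in>A. f i x"] by simp
qed simp

lemma Ck_on_mult:
  assumes "open U" "Ck_on k U f" "Ck_on k U g"
  shows "Ck_on k U (\<lambda>x. f x * g x)"
  using assms(2,3)
proof (induction k arbitrary: f g)
  case 0
  then show ?case by (auto intro: continuous_on_mult)
next
  case (Suc k)
  have "Ck_on k U (partial_deriv b (\<lambda>x. f x * g x))" if "b \<in> Basis" for b
  proof (subst Ck_on_cong[OF assms(1)])
    show "partial_deriv b (\<lambda>x. f x * g x) x = f x * partial_deriv b g x + partial_deriv b f x * g x"
      if "x \<in> U" for x
      using Suc.prems that by (auto intro!: partial_deriv_mult)
    show "Ck_on k U (\<lambda>x. f x * partial_deriv b g x + partial_deriv b f x * g x)"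
    proof (rule Ck_on_add[OF assms(1)])
      show "Ck_on k U (\<lambda>x. f x * partial_deriv b g x)"
        using Suc.prems that Ck_on_Suc_imp[of k U f] by (intro Suc.IH) auto
      show "Ck_on k U (\<lambda>x. partial_deriv b f x * g x)"
        using Suc.prems that Ck_on_Suc_imp[of k U g] by (intro Suc.IH) auto
    qed
  qed
  then show ?case using Suc.prems by (auto intro: differentiable_mult)
qed

text \<open>The induction varies \<open>F\<close> and keeps \<open>f\<close>: by the chain rule a
  partial derivative is \<open>F'(f)\<close> times one of \<open>f\<close>, and \<open>F'(f)\<close>
  is again a composition, covered by the induction hypothesis for \<open>F'\<close>.\<close>

lemma Ck_on_compose:
  fixes F :: "real \<Rightarrow> real" and f :: "'a::euclidean_space \<Rightarrow> real"
  assumes "open U" "f ` U \<subseteq> I" "Ck_on k I F" "Ck_on k U f"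
  shows "Ck_on k U (\<lambda>x. F (f x))"
  using assms(3,4)
proof (induction k arbitrary: F)
  case 0
  then show ?case
    using continuous_on_compose2[of I F U f] assms(2) by simp
next
  case (Suc k)
  have dF: "F differentiable (at (f x))" and df: "f differentiable (at x)" if "x \<in> U" for x
  proof -
    have "f x \<in> I" using that assms(2) by blast
    then show "F differentiable (at (f x))" using Suc.prems(1) by simp
    show "f differentiable (at x)" using Suc.prems(2) that by simp
  qed
  have der: "((\<lambda>x. F (f x)) has_derivative
      (\<lambda>h. frechet_derivative F (at (f x)) (frechet_derivative f (at x) h))) (at x)"
    if "x \<in> U" for x
  proof -
    note df[OF that, unfolded frechet_derivative_works]
    moreover note dF[OF that, unfolded frechet_derivative_works]
    ultimately show ?thesis
      by (rule has_derivative_compose)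
  qed
  have pd: "partial_deriv b (\<lambda>x. F (f x)) x = partial_deriv 1 F (f x) * partial_deriv b f x"
    if "x \<in> U" for x b
  proof -
    have "linear (frechet_derivative F (at (f x)))"
      by (rule linear_frechet_derivative[OF dF[OF that]])
    from linear_scale[OF this, of "frechet_derivative f (at x) b" 1] show ?thesis
      using partial_deriv_eq[OF der[OF that]] by (simp add: partial_deriv_def)
  qed
  have "Ck_on k U (partial_deriv b (\<lambda>x. F (f x)))" if "b \<in> Basis" for b
  proof (subst Ck_on_cong[OF assms(1)])
    show "partial_deriv b (\<lambda>x. F (f x)) x = partial_deriv 1 F (f x) * partial_deriv b f x"
      if "x \<in> U" for x using pd that by blast
    show "Ck_on k U (\<lambda>x. partial_deriv 1 F (f x) * partial_deriv b f x)"
    proof (rule Ck_on_mult[OF assms(1)])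
      show "Ck_on k U (\<lambda>x. partial_deriv 1 F (f x))"
        using Suc.prems Ck_on_Suc_imp[of k U f] by (rule_tac Suc.IH[of "partial_deriv 1 F"]) simp_all
      show "Ck_on k U (partial_deriv b f)"
        using Suc.prems that by simp
    qed
  qed
  moreover have "(\<lambda>x. F (f x)) differentiable (at x)" if "x \<in> U" for x
    using der[OF that] by (rule differentiableI)
  ultimately show ?case by simp
qed

lemma partial_deriv_real:
  fixes f :: "real \<Rightarrow> real"
  assumes "(f has_real_derivative d) (at x)"
  shows "partial_deriv 1 f x = d"
  using partial_deriv_eq[OF assms[unfolded has_field_derivative_def], of 1] by simp

lemma Ck_on_Suc_realI:
  fixes f :: "real \<Rightarrow> real"
  assumes "open I" "\<And>x. x \<in> I \<Longrightarrow> (f has_real_derivative f' x) (at x)" "Ck_on k I f'"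
  shows "Ck_on (Suc k) I f"
proof -
  have "Ck_on k I (partial_deriv 1 f)"
    by (subst Ck_on_cong[OF assms(1), of _ f']) (auto intro: partial_deriv_real assms)
  moreover have "f differentiable (at x)" if "x \<in> I" for x
    using assms(2)[OF that] real_differentiable_def by blast
  ultimately show ?thesis by simp
qed

lemma Ck_on_inner: "Ck_on k U (\<lambda>x. x \<bullet> c)"
proof (cases k)
  case (Suc m)
  have "partial_deriv b (\<lambda>x. x \<bullet> c) = (\<lambda>x. b \<bullet> c)" for b :: 'a
    by (rule ext, rule partial_deriv_eq) (auto intro!: derivative_eq_intros)
  then show ?thesis using Suc by (auto intro!: differentiableI derivative_eq_intros)
qed (auto intro!: continuous_intros)

lemma smooth_on_const [simp]: "smooth_on U (\<lambda>x. c)"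
  by (simp add: smooth_on_def)

lemma smooth_on_inner [simp]: "smooth_on U (\<lambda>x. x \<bullet> c)"
  by (simp add: smooth_on_def Ck_on_inner)

lemma smooth_on_cong:
  "open U \<Longrightarrow> (\<And>y. y \<in> U \<Longrightarrow> f y = g y) \<Longrightarrow> smooth_on U f \<longleftrightarrow> smooth_on U g"
  unfolding smooth_on_def using Ck_on_cong by blast

lemma smooth_on_subset: "smooth_on U f \<Longrightarrow> T \<subseteq> U \<Longrightarrow> smooth_on T f"
  unfolding smooth_on_def using Ck_on_subset by blast

lemma smooth_on_mult: "open U \<Longrightarrow> smooth_on U f \<Longrightarrow> smooth_on U g \<Longrightarrow> smooth_on U (\<lambda>x. f x * g x)"
  unfolding smooth_on_def using Ck_on_mult by blast

lemma smooth_on_sum: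
  "open U \<Longrightarrow> finite A \<Longrightarrow> (\<And>i. i \<in> A \<Longrightarrow> smooth_on U (f i)) \<Longrightarrow> smooth_on U (\<lambda>x. \<Sum>i\<in>A. f i x)"
  unfolding smooth_on_def using Ck_on_sum by blast

lemma smooth_on_compose:
  fixes F :: "real \<Rightarrow> real"
  shows "open U \<Longrightarrow> smooth_on I F \<Longrightarrow> smooth_on U f \<Longrightarrow> f ` U \<subseteq> I \<Longrightarrow> smooth_on U (\<lambda>x. F (f x))"
  unfolding smooth_on_def using Ck_on_compose by blast

lemma smooth_on_powr: "smooth_on {0<..} (\<lambda>x::real. x powr s)"
  unfolding smooth_on_def
proof
  fix k show "Ck_on k {0<..} (\<lambda>x::real. x powr s)"
  proof (induction k arbitrary: s)
    case 0
    then show ?case by (auto intro!: continuous_intros)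
  next
    case (Suc k)
    have "Ck_on k {0<..} (\<lambda>x::real. s * x powr (s - 1))"
      by (intro Ck_on_mult Suc.IH) auto
    then show ?case
      by (rule Ck_on_Suc_realI[rotated 2]) (auto intro: has_real_derivative_powr)
  qed
qed

lemma smooth_on_ln: "smooth_on {0<..} (ln :: real \<Rightarrow> real)"
  unfolding smooth_on_def
proof
  fix k show "Ck_on k {0<..} (ln :: real \<Rightarrow> real)"
  proof (cases k)
    case 0
    then show ?thesis by (auto intro!: continuous_intros)
  next
    case (Suc m)
    have "(ln has_real_derivative x powr (-1)) (at x)" if "x \<in> {0<..}" for x :: real
      using that DERIV_ln[of x] by (simp add: powr_minus)
    then show ?thesis unfolding Suc
      using smooth_on_powr[of "-1"]
      by (intro Ck_on_Suc_realI[where f' = "\<lambda>x. x powr (-1)"]) (auto simp: smooth_on_def)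
  qed
qed

lemma smooth_on_partial_deriv: "smooth_on U f \<Longrightarrow> b \<in> Basis \<Longrightarrow> smooth_on U (partial_deriv b f)"
  unfolding smooth_on_def
proof
  fix k assume "\<forall>k. Ck_on k U f" "b \<in> Basis"
  then show "Ck_on k U (partial_deriv b f)" by (auto dest: spec[of _ "Suc k"])
qed

lemma smooth_on_partial_derivs:
  "smooth_on U f \<Longrightarrow> set bs \<subseteq> Basis \<Longrightarrow> smooth_on U (partial_derivs bs f)"
  by (induction bs) (auto intro: smooth_on_partial_deriv)

lemma smooth_on_laplacian: "open U \<Longrightarrow> smooth_on U f \<Longrightarrow> smooth_on U (laplacian f)"
  unfolding laplacian_def[abs_def]
  by (intro smooth_on_sum smooth_on_partial_deriv) auto

lemma smooth_on_continuous: "smooth_on U f \<Longrightarrow> continuous_on U f"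
  unfolding smooth_on_def using Ck_on_continuous_on by blast

lemma smooth_on_differentiable: "smooth_on U f \<Longrightarrow> x \<in> U \<Longrightarrow> f differentiable (at x)"
  unfolding smooth_on_def by (auto dest: spec[of _ "Suc 0"])

section \<open>Integration by parts across a point\<close>

lemma lebesgue_integral_translation_lborel:
  fixes f :: "'a::euclidean_space \<Rightarrow> real"
  assumes "f \<in> borel_measurable borel"
  shows "(LINT x|lborel. f (c + x)) = (LINT x|lborel. f x)"
proof -
  have "(LINT x|lborel. f x) = (LINT x|distr lborel borel ((+) c). f x)"
    by (subst lborel_distr_plus) simp
  also have "\<dots> = (LINT x|lborel. f (c + x))"
    by (subst integral_distr) (use assms in auto)
  finally show ?thesis by simp
qed

lemma integrable_lborel_translation:
  fixes f :: "'a::euclidean_space \<Rightarrow> real"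
  assumes "integrable lborel f"
  shows "integrable lborel (\<lambda>x. f (c + x))"
proof -
  have "integrable (distr lborel borel ((+) c)) f"
    by (subst lborel_distr_plus) (rule assms)
  then show ?thesis
    by (subst (asm) integrable_distr_eq) (use assms in auto)
qed

lemma integrable_lborel_bounded_support:
  fixes f :: "'a::euclidean_space \<Rightarrow> real"
  assumes "f \<in> borel_measurable borel" "\<And>x. \<bar>f x\<bar> \<le> M" "\<And>x. norm x > R \<Longrightarrow> f x = 0"
  shows "integrable lborel f"
proof (rule Bochner_Integration.integrable_bound)
  show "integrable lborel (\<lambda>x::'a. M * indicator (cball 0 R) x)"
    using emeasure_bounded_finite[OF bounded_cball[of "0::'a" R]] by simp
  show "f \<in> borel_measurable lborel" using assms(1) by simp
  show "AE x in lborel. norm (f x) \<le> norm (M * indicator (cball 0 R) x)"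
  proof (rule AE_I2)
    fix x
    have "\<bar>f x\<bar> \<le> \<bar>M\<bar>" using assms(2)[of x] by simp
    then show "norm (f x) \<le> norm (M * indicator (cball 0 R) x)"
      using assms(3)[of x] by (cases "norm x > R") (auto simp: indicator_def)
  qed
qed

text \<open>The difference quotients have integral zero by translation invariance and are dominated
  thanks to the bound on the derivative.\<close>

lemma integral_partial_deriv_eq_0:
  fixes \<psi> :: "'a::euclidean_space \<Rightarrow> real"
  assumes diff: "\<And>x. \<psi> differentiable (at x)"
    and bnd: "\<And>x. \<bar>partial_deriv b \<psi> x\<bar> \<le> M"
    and supp: "\<And>x. norm x > R \<Longrightarrow> \<psi> x = 0"
    and b: "b \<in> Basis"
  shows "integrable lborel (partial_deriv b \<psi>)" "(LINT x|lborel. partial_deriv b \<psi> x) = 0"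
proof -
  define h where "h n = inverse (real (Suc n))" for n
  have h: "0 < h n" "h n \<le> 1" for n by (auto simp: h_def inverse_le_1_iff)
  have hlim: "h \<longlonglongrightarrow> 0" unfolding h_def by (rule LIMSEQ_inverse_real_of_nat)
  define s where "s n x = (\<psi> (h n *\<^sub>R b + x) - \<psi> x) / h n" for n x
  have line: "((\<lambda>t. \<psi> (t *\<^sub>R b + x)) has_real_derivative partial_deriv b \<psi> (t *\<^sub>R b + x)) (at t)" for t x
  proof -
    let ?D = "frechet_derivative \<psi> (at (t *\<^sub>R b + x))"
    have 1: "(\<psi> has_derivative ?D) (at (t *\<^sub>R b + x))"
      using diff frechet_derivative_works by blast
    have 2: "((\<lambda>t. t *\<^sub>R b + x) has_derivative (\<lambda>k. k *\<^sub>R b)) (at t)"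
      by (auto intro!: derivative_eq_intros)
    have "((\<lambda>t. \<psi> (t *\<^sub>R b + x)) has_derivative (\<lambda>k. ?D (k *\<^sub>R b))) (at t)"
      using has_derivative_compose[OF 2 1] .
    moreover have "?D (k *\<^sub>R b) = partial_deriv b \<psi> (t *\<^sub>R b + x) * k" for k
      using linear_scale[OF linear_frechet_derivative[OF diff], of _ k b] by (simp add: partial_deriv_def)
    ultimately show ?thesis by (simp add: has_field_derivative_def)
  qed
  have cont: "continuous_on UNIV \<psi>"
    using diff by (simp add: continuous_at_imp_continuous_on differentiable_imp_continuous_within)
  then have meas [measurable]: "\<psi> \<in> borel_measurable borel"
    by (rule borel_measurable_continuous_onI)
  have M0: "0 \<le> M" using bnd[of 0] by simp
  have "bounded (\<psi> ` cball 0 R)"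
    by (intro compact_imp_bounded compact_continuous_image continuous_on_subset[OF cont]) auto
  then obtain K where K: "\<And>x. norm x \<le> R \<Longrightarrow> \<bar>\<psi> x\<bar> \<le> K"
    unfolding bounded_iff by fastforce
  have int: "integrable lborel \<psi>"
  proof (rule integrable_lborel_bounded_support[where M = "max K 0" and R = R])
    show "\<bar>\<psi> x\<bar> \<le> max K 0" for x
      using K[of x] supp[of x] by (cases "norm x \<le> R") auto
  qed (use supp in auto)
  have sint: "integrable lborel (s n)" "(LINT x|lborel. s n x) = 0" for n
  proof -
    note i = integrable_lborel_translation[OF int, of "h n *\<^sub>R b"]
    show "integrable lborel (s n)" unfolding s_def[abs_def] using i int by auto
    show "(LINT x|lborel. s n x) = 0"
      unfolding s_def using i int lebesgue_integral_translation_lborel[OF meas, of "h n *\<^sub>R b"]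
      by (simp add: Bochner_Integration.integral_diff)
  qed
  \<comment> \<open>The increments \<open>h n *\<^sub>R b\<close> have length at most 1, so every
    quotient vanishes outside radius \<open>R + 1\<close>, and a single ball serves for all
    \<open>n\<close>.\<close>
  have sbnd: "\<bar>s n x\<bar> \<le> M * indicator (cball 0 (R + 1)) x" for n x
  proof (cases "norm x \<le> R + 1")
    case True
    obtain z where z: "\<psi> (h n *\<^sub>R b + x) - \<psi> (0 *\<^sub>R b + x) = (h n - 0) * partial_deriv b \<psi> (z *\<^sub>R b + x)"
      using MVT2[of 0 "h n" "\<lambda>t. \<psi> (t *\<^sub>R b + x)" "\<lambda>t. partial_deriv b \<psi> (t *\<^sub>R b + x)"] h line
      by blast
    then have "s n x = partial_deriv b \<psi> (z *\<^sub>R b + x)"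
      using h(1)[of n] by (simp add: s_def)
    then show ?thesis using bnd True by simp
  next
    case False
    have "norm x \<le> norm (h n *\<^sub>R b + x) + norm (h n *\<^sub>R b)"
      by (metis add_diff_cancel_left' norm_triangle_ineq4)
    moreover have "norm (h n *\<^sub>R b) \<le> 1" using h[of n] b by simp
    ultimately have "norm (h n *\<^sub>R b + x) > R" using False by simp
    then have "s n x = 0" using supp False by (simp add: s_def)
    then show ?thesis using False by simp
  qed
  have slim: "(\<lambda>n. s n x) \<longlonglongrightarrow> partial_deriv b \<psi> x" for x
  proof -
    have "((\<lambda>t. (\<psi> ((0 + t) *\<^sub>R b + x) - \<psi> (0 *\<^sub>R b + x)) / t) \<longlongrightarrow> partial_deriv b \<psi> (0 *\<^sub>R b + x)) (at 0)"
      using line[of x 0] unfolding DERIV_def .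
    then have "((\<lambda>t. (\<psi> (t *\<^sub>R b + x) - \<psi> x) / t) \<longlongrightarrow> partial_deriv b \<psi> x) (at 0)" by simp
    moreover have "filterlim h (at 0) sequentially"
      unfolding filterlim_at using hlim h(1) by (auto simp: less_imp_neq[symmetric] intro!: always_eventually)
    ultimately show ?thesis unfolding s_def using filterlim_compose by blast
  qed
  \<comment> \<open>Measurability of the derivative comes from its being a pointwise limit of the
    quotients.\<close>
  have meas': "partial_deriv b \<psi> \<in> borel_measurable lborel"
    by (rule borel_measurable_LIMSEQ_real[OF slim]) (use sint in auto)
  have dom: "integrable lborel (\<lambda>x::'a. M * indicator (cball 0 (R + 1)) x)"
    using emeasure_bounded_finite[OF bounded_cball[of "0::'a" "R + 1"]] by simp
  show "integrable lborel (partial_deriv b \<psi>)"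
    by (rule integrable_dominated_convergence[OF meas' _ dom, of s]) (use sint sbnd slim in auto)
  have "(\<lambda>n. LINT x|lborel. s n x) \<longlonglongrightarrow> (LINT x|lborel. partial_deriv b \<psi> x)"
    by (rule integral_dominated_convergence[OF meas' _ dom]) (use sint sbnd slim in auto)
  then show "(LINT x|lborel. partial_deriv b \<psi> x) = 0"
    using LIMSEQ_unique[OF _ tendsto_const[of 0]] by (simp add: sint(2))
qed

section \<open>A cutoff of class \<open>C^1\<close>, equal to 0 up to 1 and to 1 from 2 on\<close>

definition cutoff :: "real \<Rightarrow> real" where
  "cutoff s = 1 - (max 0 (1 - (max 0 (s - 1))\<^sup>2))\<^sup>2"

definition cutoff' :: "real \<Rightarrow> real" where
  "cutoff' s = 4 * max 0 (1 - (max 0 (s - 1))\<^sup>2) * max 0 (s - 1)"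

text \<open>The squared positive part is the building block of \<open>cutoff\<close>. One derivative
  is all that a single integration by parts asks of a cutoff, so a piecewise polynomial can replace
  a smooth bump function.\<close>

lemma has_real_derivative_max_0_square:
  "((\<lambda>s::real. (max 0 s)\<^sup>2) has_real_derivative 2 * max 0 s) (at s)"
proof -
  consider "s < 0" | "s > 0" | "s = 0" by linarith
  then show ?thesis
  proof cases
    case 1
    have "((\<lambda>s::real. 0) has_real_derivative 0) (at s)" by simp
    then have "((\<lambda>s::real. (max 0 s)\<^sup>2) has_real_derivative 0) (at s)"
      by (rule has_field_derivative_transform_within_open[of _ _ _ "{..<0}"]) (use 1 in auto)
    then show ?thesis using 1 by simp
  next
    case 2
    have "((\<lambda>s::real. s\<^sup>2) has_real_derivative 2 * s) (at s)" by (auto intro!: derivative_eq_intros)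
    then have "((\<lambda>s::real. (max 0 s)\<^sup>2) has_real_derivative 2 * s) (at s)"
      by (rule has_field_derivative_transform_within_open[of _ _ _ "{0<..}"]) (use 2 in auto)
    then show ?thesis using 2 by simp
  next
    case 3
    have "((\<lambda>h::real. (max 0 h)\<^sup>2 / h) \<longlongrightarrow> 0) (at 0)"
    proof (rule Lim_null_comparison)
      show "\<forall>\<^sub>F h::real in at 0. norm ((max 0 h)\<^sup>2 / h) \<le> \<bar>h\<bar>"
        by (rule always_eventually) (auto simp: max_def power2_eq_square)
      show "((\<lambda>h::real. \<bar>h\<bar>) \<longlongrightarrow> 0) (at 0)" by (auto intro!: tendsto_eq_intros)
    qed
    then show ?thesis using 3 by (simp add: DERIV_def)
  qed
qed

lemma has_real_derivative_cutoff: "(cutoff has_real_derivative cutoff' s) (at s)"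
proof -
  have "((\<lambda>s. 1 - (max 0 (s - 1))\<^sup>2) has_real_derivative - (2 * max 0 (s - 1))) (at s)"
  proof -
    have "((\<lambda>s. s - 1) has_real_derivative 1) (at s)" by (auto intro!: derivative_eq_intros)
    from DERIV_diff[OF DERIV_const[of 1] DERIV_chain'[OF this has_real_derivative_max_0_square]]
    show ?thesis by simp
  qed
  from DERIV_diff[OF DERIV_const[of 1] DERIV_chain'[OF this has_real_derivative_max_0_square]]
  have "(cutoff has_real_derivative
      0 - - (2 * max 0 (s - 1)) * (2 * max 0 (1 - (max 0 (s - 1))\<^sup>2))) (at s)"
    by (simp add: cutoff_def[abs_def] mult.commute)
  then show ?thesis by (simp add: cutoff'_def mult_ac)
qed

lemma cutoff_range: "0 \<le> cutoff s" "cutoff s \<le> 1"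
  by (auto simp: cutoff_def max_def power_le_one)

lemma cutoff_eq_0: "s \<le> 1 \<Longrightarrow> cutoff s = 0"
  by (simp add: cutoff_def)

lemma cutoff_eq_1:
  assumes "s \<ge> 2"
  shows "cutoff s = 1"
proof -
  have "1 \<le> (s - 1)\<^sup>2" using assms by (intro one_le_power) simp
  then show ?thesis using assms by (simp add: cutoff_def)
qed

lemma cutoff'_eq_0:
  assumes "s \<le> 1 \<or> s \<ge> 2"
  shows "cutoff' s = 0"
proof (cases "s \<le> 1")
  case False
  then have "1 \<le> (s - 1)\<^sup>2" using assms by (intro one_le_power) simp
  then show ?thesis using False by (simp add: cutoff'_def)
qed (simp add: cutoff'_def)

lemma abs_cutoff'_le: "\<bar>cutoff' s\<bar> \<le> 4"
proof (cases "s \<le> 1 \<or> s \<ge> 2")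
  case False
  have "max 0 (1 - (max 0 (s - 1))\<^sup>2) \<le> 1" by (simp add: max_def)
  moreover have "max 0 (s - 1) \<le> 1" using False by simp
  ultimately have "max 0 (1 - (max 0 (s - 1))\<^sup>2) * max 0 (s - 1) \<le> 1 * 1"
    by (intro mult_mono) auto
  then show ?thesis by (simp add: cutoff'_def abs_mult)
qed (simp add: cutoff'_eq_0)

section \<open>Test functions and integrals against them\<close>

lemma test_functionI:
  assumes "test_function U \<phi>" "smooth_on UNIV \<psi>"
    and "\<And>x. x \<notin> closure {x. \<phi> x \<noteq> 0} \<Longrightarrow> \<psi> x = 0"
  shows "test_function U \<psi>"
proof -
  have "closure {x. \<psi> x \<noteq> 0} \<subseteq> closure {x. \<phi> x \<noteq> 0}"
    using assms(3) by (intro closure_minimal) auto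
  moreover from this have "compact (closure {x. \<psi> x \<noteq> 0})"
    using assms(1) compact_Int_closed[of "closure {x. \<phi> x \<noteq> 0}" "closure {x. \<psi> x \<noteq> 0}"]
    by (simp add: test_function_def Int_absorb1)
  ultimately show ?thesis using assms(1,2) unfolding test_function_def by blast
qed

lemma not_in_closure_support:
  "x \<notin> closure {x. \<phi> x \<noteq> 0} \<Longrightarrow> \<phi> x = 0"
  using closure_subset[of "{x. \<phi> x \<noteq> 0}"] by blast

lemma partial_deriv_eq_0_outside_support:
  assumes "x \<notin> closure {x. \<phi> x \<noteq> 0}"
  shows "partial_deriv b \<phi> x = 0"
proof -
  have "partial_deriv b \<phi> x = partial_deriv b (\<lambda>x. 0) x"
  proof (rule partial_deriv_cong)
    show "open (- closure {x. \<phi> x \<noteq> 0})" by (intro open_Compl closed_closure)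
    show "x \<in> - closure {x. \<phi> x \<noteq> 0}" using assms by simp
    show "\<phi> y = 0" if "y \<in> - closure {x. \<phi> x \<noteq> 0}" for y
      using that not_in_closure_support[of y \<phi>] by blast
  qed
  then show ?thesis by simp
qed

lemma test_function_partial_deriv:
  "test_function U \<phi> \<Longrightarrow> b \<in> Basis \<Longrightarrow> test_function U (partial_deriv b \<phi>)"
  by (rule test_functionI[of U \<phi>])
    (auto simp: test_function_def partial_deriv_eq_0_outside_support intro: smooth_on_partial_deriv)

lemma test_function_partial_derivs:
  "test_function U \<phi> \<Longrightarrow> set bs \<subseteq> Basis \<Longrightarrow> test_function U (partial_derivs bs \<phi>)"
  by (induction bs) (auto intro: test_function_partial_deriv)

lemma test_function_laplacian:
  assumes "test_function U \<phi>"
  shows "test_function U (laplacian \<phi>)"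
proof (rule test_functionI[OF assms])
  show "smooth_on UNIV (laplacian \<phi>)"
    using assms by (auto simp: test_function_def intro: smooth_on_laplacian)
  fix x assume x: "x \<notin> closure {x. \<phi> x \<noteq> 0}"
  have "closure {x. partial_deriv b \<phi> x \<noteq> 0} \<subseteq> closure {x. \<phi> x \<noteq> 0}" for b
    using partial_deriv_eq_0_outside_support[of _ \<phi> b] by (intro closure_minimal) auto
  then have "partial_deriv b (partial_deriv b \<phi>) x = 0" for b
    using x by (intro partial_deriv_eq_0_outside_support) blast
  then show "laplacian \<phi> x = 0" by (simp add: laplacian_def)
qed

lemma test_function_continuous: "test_function U \<phi> \<Longrightarrow> continuous_on UNIV \<phi>"
  by (simp add: test_function_def smooth_on_continuous)

lemma test_function_measurable:
  "test_function U \<phi> \<Longrightarrow> \<phi> \<in> borel_measurable (lebesgue_on A)"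
  by (intro measurable_restrict_space1 measurable_completion)
    (simp add: borel_measurable_continuous_onI test_function_continuous)

lemma test_function_bounded:
  assumes "test_function U \<phi>"
  obtains M where "M > 0" "\<And>x. \<bar>\<phi> x\<bar> \<le> M"
proof -
  let ?K = "closure {x. \<phi> x \<noteq> 0}"
  have "compact (\<phi> ` ?K)"
    using assms test_function_continuous[OF assms]
    by (intro compact_continuous_image) (auto simp: test_function_def intro: continuous_on_subset)
  from compact_imp_bounded[OF this] obtain M where "M > 0" and M: "\<And>x. x \<in> ?K \<Longrightarrow> \<bar>\<phi> x\<bar> \<le> M"
    unfolding bounded_pos by auto
  moreover have "\<bar>\<phi> x\<bar> \<le> M" for x
    using M[of x] not_in_closure_support[of x \<phi>] \<open>M > 0\<close> by (cases "x \<in> ?K") auto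
  ultimately show ?thesis using that by blast
qed

lemma integrable_bounded_mult:
  fixes f g :: "'a \<Rightarrow> real"
  assumes "integrable M f" "g \<in> borel_measurable M" "\<And>x. \<bar>g x\<bar> \<le> B"
  shows "integrable M (\<lambda>x. g x * f x)"
proof (rule Bochner_Integration.integrable_bound)
  show "integrable M (\<lambda>x. B * f x)" using assms(1) by simp
  show "(\<lambda>x. g x * f x) \<in> borel_measurable M" using assms by simp
  show "AE x in M. norm (g x * f x) \<le> norm (B * f x)"
  proof (rule AE_I2)
    fix x
    have "\<bar>g x\<bar> \<le> \<bar>B\<bar>" using assms(3)[of x] by simp
    then show "norm (g x * f x) \<le> norm (B * f x)" by (simp add: abs_mult mult_right_mono)
  qed
qed

lemma integrable_mult_test_function:
  assumes "integrable (lebesgue_on U) f" "test_function V \<phi>"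
  shows "integrable (lebesgue_on U) (\<lambda>x. f x * \<phi> x)"
proof -
  obtain M where "\<And>x. \<bar>\<phi> x\<bar> \<le> M" using test_function_bounded[OF assms(2)] by blast
  from integrable_bounded_mult[OF assms(1) test_function_measurable[OF assms(2)] this]
  show ?thesis by (simp add: mult.commute)
qed

text \<open>The bridge between \<open>lebesgue_on U\<close>, in which weak derivatives are defined,
  and \<open>lborel\<close>, whose translation invariance was used for the vanishing
  integral.\<close>

lemma lebesgue_on_integral_eq_lborel:
  fixes f :: "'a::euclidean_space \<Rightarrow> real"
  assumes "integrable lborel f" "open U" "\<And>x. x \<notin> U \<Longrightarrow> f x = 0"
  shows "integrable (lebesgue_on U) f" "(LINT x|lebesgue_on U. f x) = (LINT x|lborel. f x)"
proof -
  have eq: "(\<lambda>x. indicator U x *\<^sub>R f x) = f"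
    using assms(3) by (fastforce simp: indicator_def)
  have "integrable lebesgue f"
    using assms(1) by (subst integrable_completion) auto
  then show "integrable (lebesgue_on U) f"
    using assms(2) by (subst integrable_restrict_space) (auto simp: eq[simplified])
  have "(LINT x|lebesgue_on U. f x) = (LINT x|lebesgue. indicator U x *\<^sub>R f x)"
    using assms(2) by (intro integral_restrict_space) simp
  also note eq
  also have "(LINT x|lebesgue. f x) = (LINT x|lborel. f x)"
    using assms(1) by (intro integral_completion) auto
  finally show "(LINT x|lebesgue_on U. f x) = (LINT x|lborel. f x)" .
qed

lemma AE_lebesgue_on_neq:
  fixes c :: "'a::euclidean_space"
  assumes "U \<in> sets lebesgue"
  shows "AE x in lebesgue_on U. x \<noteq> c"
proof -
  have "AE x in lborel. x \<noteq> c" by (rule AE_lborel_singleton)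
  then have "AE x in lebesgue. x \<noteq> c" by (rule AE_completion)
  then show ?thesis using assms by (subst AE_restrict_space_iff) auto
qed

lemma integral_small_support_bound:
  fixes f :: "'a::euclidean_space \<Rightarrow> real"
  assumes f: "integrable (lebesgue_on U) f" and U: "open U"
    and bnd: "\<And>x. x \<in> U \<Longrightarrow> \<bar>f x\<bar> \<le> c * indicator (ball 0 r) x" and "c \<ge> 0" "r \<ge> 0"
  shows "\<bar>LINT x|lebesgue_on U. f x\<bar> \<le> c * (unit_ball_vol (DIM('a)) * r ^ DIM('a))"
proof -
  have f': "integrable lebesgue (\<lambda>x. indicator U x *\<^sub>R f x)"
    using f U by (subst (asm) integrable_restrict_space) auto
  have i: "integrable lebesgue (\<lambda>x::'a. c * indicator (ball 0 r) x)"
    using emeasure_bounded_finite[OF bounded_ball[of "0::'a" r]] by simp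
  have "\<bar>LINT x|lebesgue_on U. f x\<bar> = \<bar>LINT x|lebesgue. indicator U x *\<^sub>R f x\<bar>"
    using U by (subst integral_restrict_space) auto
  also have "\<dots> \<le> (LINT x|lebesgue. \<bar>indicator U x *\<^sub>R f x\<bar>)"
    by (rule integral_abs_bound)
  also have "\<dots> \<le> (LINT x|lebesgue. c * indicator (ball 0 r) (x::'a))"
  proof (rule integral_mono)
    show "\<bar>indicator U x *\<^sub>R f x\<bar> \<le> c * indicator (ball 0 r) x" for x
      using bnd[of x] \<open>c \<ge> 0\<close> by (cases "x \<in> U") auto
  qed (use f' i in auto)
  also have "\<dots> = c * measure lebesgue (ball (0::'a) r)" by simp
  also have "measure lebesgue (ball (0::'a) r) = unit_ball_vol (DIM('a)) * r ^ DIM('a)"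
    using content_ball[of r "0::'a"] \<open>r \<ge> 0\<close> by simp
  finally show ?thesis .
qed

section \<open>Cutting off a singular vector field at the origin\<close>

lemma continuous_on_cutoff': "continuous_on S cutoff'"
  unfolding cutoff'_def[abs_def] by (intro continuous_intros)

lemma continuous_on_cutoff: "continuous_on S cutoff"
  unfolding cutoff_def[abs_def] by (intro continuous_intros)

lemma has_derivative_cutoff_scaled:
  "((\<lambda>x. cutoff (c * (x \<bullet> x))) has_derivative (\<lambda>h. cutoff' (c * (x \<bullet> x)) * (2 * c * (x \<bullet> h)))) (at x)"
proof -
  have 1: "((\<lambda>x. c * (x \<bullet> x)) has_derivative (\<lambda>h. 2 * c * (x \<bullet> h))) (at x)"
    by (auto intro!: derivative_eq_intros simp: inner_commute)
  have 2: "(cutoff has_derivative (*) (cutoff' (c * (x \<bullet> x)))) (at (c * (x \<bullet> x)))"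
    using has_real_derivative_cutoff by (simp add: has_field_derivative_def)
  show ?thesis using has_derivative_compose[OF 1 2] by simp
qed

text \<open>\<open>F\<close> is the product rule applied to cutoff times \<open>\<phi>\<close> times
  \<open>X\<close>. The cutoff removes the origin and \<open>\<phi>\<close> the outside of a compact
  set, so the product extends by zero to a function differentiable on the whole space, and its
  derivative has integral zero.\<close>

lemma integral_div_cutoff:
  fixes X :: "'a::euclidean_space \<Rightarrow> real"
  assumes U: "open U" and X: "Ck_on (Suc 0) (U - {0}) X" and b: "b \<in> Basis"
    and \<phi>: "test_function U \<phi>" and c: "c > 0"
  defines "F \<equiv> \<lambda>x. cutoff (c * (x \<bullet> x)) * \<phi> x * partial_deriv b X x
      + cutoff (c * (x \<bullet> x)) * partial_deriv b \<phi> x * X x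
      + (cutoff' (c * (x \<bullet> x)) * (2 * c * (x \<bullet> b))) * \<phi> x * X x"
  shows "integrable (lebesgue_on U) F" "(LINT x|lebesgue_on U. F x) = 0"
proof -
  define K where "K = closure {x. \<phi> x \<noteq> 0}"
  define \<eta> where "\<eta> x = cutoff (c * (x \<bullet> x))" for x :: 'a
  define \<eta>' where "\<eta>' x = cutoff' (c * (x \<bullet> x)) * (2 * c * (x \<bullet> b))" for x :: 'a
  define \<psi> where "\<psi> x = \<eta> x * \<phi> x * X x" for x
  have K: "compact K" "K \<subseteq> U" using \<phi> by (auto simp: K_def test_function_def)
  have phi0: "\<phi> x = 0" "partial_deriv b \<phi> x = 0" if "x \<notin> K" for x
    using that not_in_closure_support[of x \<phi>] partial_deriv_eq_0_outside_support[of x \<phi> b]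
    by (auto simp: K_def)
  \<comment> \<open>Within this radius \<open>c * (x \<bullet> x)\<close> is at most 1, where the
    cutoff and its derivative vanish.\<close>
  define r where "r = 1 / sqrt c"
  have r: "r > 0" using c by (simp add: r_def)
  have small: "c * (x \<bullet> x) \<le> 1" if "norm x \<le> r" for x :: 'a
  proof -
    have "x \<bullet> x \<le> r\<^sup>2"
      using that by (simp add: power2_norm_eq_inner[symmetric] power_mono)
    also have "r\<^sup>2 = 1 / c" using c by (simp add: r_def power_divide)
    finally show ?thesis using c by (simp add: field_simps)
  qed
  have eta0: "\<eta> x = 0" "\<eta>' x = 0" if "norm x \<le> r" for x
    using small[OF that] by (simp_all add: \<eta>_def \<eta>'_def cutoff_eq_0 cutoff'_eq_0)
  have F: "F x = \<eta> x * \<phi> x * partial_deriv b X x + \<eta> x * partial_deriv b \<phi> x * X x + \<eta>' x * \<phi> x * X x"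
    for x by (simp add: F_def \<eta>_def \<eta>'_def)
  have deriv: "\<psi> differentiable (at x) \<and> partial_deriv b \<psi> x = F x" for x
  proof -
    \<comment> \<open>In the first two regions the product is zero on an open neighbourhood,
      whatever \<open>X\<close> does there; in the third all three factors are
      differentiable.\<close>
    consider "x \<notin> K" | "norm x < r" | "x \<in> K" "x \<noteq> 0" using r by fastforce
    then show ?thesis
    proof cases
      case 1
      have o: "open (- K)" using K(1) by (intro open_Compl compact_imp_closed)
      have z: "\<psi> y = 0" if "y \<in> - K" for y using that phi0 by (simp add: \<psi>_def)
      have "\<psi> differentiable (at x)"
        using differentiable_cong_open[OF o, of x \<psi> "\<lambda>_. 0"] 1 z by simp
      moreover have "partial_deriv b \<psi> x = 0"
        using partial_deriv_cong[OF o, of x \<psi> "\<lambda>_. 0" b] 1 z by simp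
      ultimately show ?thesis using phi0[OF 1] by (simp add: F)
    next
      case 2
      have z: "\<psi> y = 0" if "y \<in> ball 0 r" for y using that eta0[of y] by (simp add: \<psi>_def)
      have "\<psi> differentiable (at x)"
        using differentiable_cong_open[OF open_ball, of x 0 r \<psi> "\<lambda>_. 0"] 2 z by simp
      moreover have "partial_deriv b \<psi> x = 0"
        using partial_deriv_cong[OF open_ball, of x 0 r \<psi> "\<lambda>_. 0" b] 2 z by simp
      ultimately show ?thesis using eta0[of x] 2 by (simp add: F)
    next
      case 3
      then have "x \<in> U - {0}" using K(2) by blast
      then have dX: "X differentiable (at x)" using X by simp
      have dphi: "\<phi> differentiable (at x)"
        using \<phi> smooth_on_differentiable[of UNIV \<phi> x] by (simp add: test_function_def)
      have deta: "\<eta> differentiable (at x)" "partial_deriv b \<eta> x = \<eta>' x"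
        using differentiableI[OF has_derivative_cutoff_scaled[of c x]]
          partial_deriv_eq[OF has_derivative_cutoff_scaled[of c x], of b]
        by (simp_all add: \<eta>_def[abs_def] \<eta>'_def)
      have dep: "(\<lambda>x. \<eta> x * \<phi> x) differentiable (at x)"
        by (rule differentiable_mult[OF deta(1) dphi])
      have "\<psi> differentiable (at x)"
        unfolding \<psi>_def[abs_def] by (rule differentiable_mult[OF dep dX])
      moreover have "partial_deriv b \<psi> x = F x"
        unfolding \<psi>_def[abs_def] partial_deriv_mult[OF dep dX] partial_deriv_mult[OF deta(1) dphi]
        by (simp add: deta(2) F algebra_simps)
      ultimately show ?thesis by blast
    qed
  qed
  \<comment> \<open>\<open>F\<close> lives on this compact set. It avoids the origin, so
    \<open>F\<close> is continuous on it and hence bounded.\<close>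
  define C where "C = K - ball 0 r"
  have C: "compact C" "C \<subseteq> U - {0}" unfolding C_def using K r by (auto intro: compact_diff)
  have contF: "continuous_on C F"
  proof -
    have 1: "continuous_on C X" "continuous_on C (partial_deriv b X)"
      using Ck_on_continuous_on[OF X] X b C(2) by (auto intro: continuous_on_subset)
    have 2: "continuous_on C \<phi>" "continuous_on C (partial_deriv b \<phi>)"
      using test_function_continuous[OF \<phi>] test_function_continuous[OF test_function_partial_deriv[OF \<phi> b]]
      by (auto intro: continuous_on_subset)
    have 3: "continuous_on C \<eta>" unfolding \<eta>_def[abs_def]
      by (rule continuous_on_compose2[OF continuous_on_cutoff[of UNIV]]) (auto intro!: continuous_intros)
    have "continuous_on C (\<lambda>x. cutoff' (c * (x \<bullet> x)))"
      by (rule continuous_on_compose2[OF continuous_on_cutoff'[of UNIV]]) (auto intro!: continuous_intros)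
    then have 4: "continuous_on C \<eta>'" unfolding \<eta>'_def[abs_def]
      by (intro continuous_intros)
    have "continuous_on C (\<lambda>x. \<eta> x * \<phi> x * partial_deriv b X x
        + \<eta> x * partial_deriv b \<phi> x * X x + \<eta>' x * \<phi> x * X x)"
      by (intro continuous_intros 1 2 3 4)
    then show ?thesis by (simp only: F[symmetric])
  qed
  have "bounded (F ` C)"
    by (intro compact_imp_bounded compact_continuous_image contF C(1))
  then obtain M where "M > 0" and M: "\<And>x. x \<in> C \<Longrightarrow> \<bar>F x\<bar> \<le> M"
    unfolding bounded_pos by auto
  have F0: "F x = 0" if "x \<notin> C" for x
    using that phi0[of x] eta0[of x] by (auto simp: F C_def)
  have bnd: "\<bar>F x\<bar> \<le> M" for x
    using M[of x] F0[of x] \<open>M > 0\<close> by (cases "x \<in> C") auto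
  obtain R where R: "\<And>x. x \<in> K \<Longrightarrow> norm x \<le> R"
    using compact_imp_bounded[OF K(1)] unfolding bounded_iff by blast
  have psi0: "\<psi> x = 0" if "norm x > R" for x
    using R[of x] phi0[of x] that by (auto simp: \<psi>_def)
  have eqF: "partial_deriv b \<psi> = F" using deriv by blast
  have "integrable lborel F" "(LINT x|lborel. F x) = 0"
    using integral_partial_deriv_eq_0[of \<psi> b M R] deriv bnd psi0 b unfolding eqF by blast+
  moreover have "F x = 0" if "x \<notin> U" for x
    using F0[of x] that C(2) by blast
  ultimately show "integrable (lebesgue_on U) F" "(LINT x|lebesgue_on U. F x) = 0"
    using lebesgue_on_integral_eq_lborel[of F U] U by simp_all
qed

text \<open>In dimension \<open>N\<close> with cutoff scale \<open>1/m\<close>, the derivative of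
  the cutoff is \<open>O(m)\<close>, the field there is \<open>o(m^(N-1))\<close>, and the layer has
  volume \<open>O(m^(-N))\<close>. The product tends to 0, while the other terms converge by
  dominated convergence.\<close>

lemma divergence_removable_point:
  fixes X :: "'a::euclidean_space \<Rightarrow> 'a \<Rightarrow> real"
  assumes U: "open U"
    and X: "\<And>b. b \<in> Basis \<Longrightarrow> Ck_on (Suc 0) (U - {0}) (X b)"
    and Xint: "\<And>b. b \<in> Basis \<Longrightarrow> integrable (lebesgue_on U) (X b)"
    and lim: "\<And>b. b \<in> Basis \<Longrightarrow> ((\<lambda>x. X b x * norm x ^ (DIM('a) - 1)) \<longlongrightarrow> 0) (at 0)"
    and Dint: "integrable (lebesgue_on U) (\<lambda>x. \<Sum>b\<in>Basis. partial_deriv b (X b) x)"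
    and \<phi>: "test_function U \<phi>"
  shows "(\<Sum>b\<in>Basis. LINT x|lebesgue_on U. X b x * partial_deriv b \<phi> x) =
    - (LINT x|lebesgue_on U. (\<Sum>b\<in>Basis. partial_deriv b (X b) x) * \<phi> x)"
proof -
  let ?M = "lebesgue_on U"
  define D where "D x = (\<Sum>b\<in>Basis. partial_deriv b (X b) x)" for x
  \<comment> \<open>With this choice the argument of the cutoff is the square of
    \<open>(n + 1) |x|\<close>: the cutoff is 0 when \<open>(n + 1) |x|\<close> is at most 1, and
    surely 1 when it is at least 2.\<close>
  define c where "c n = (real (Suc n))\<^sup>2" for n
  define \<eta> where "\<eta> n x = cutoff (c n * (x \<bullet> x))" for n and x :: 'a
  define \<eta>' where "\<eta>' b n x = cutoff' (c n * (x \<bullet> x)) * (2 * c n * (x \<bullet> b))" for b n and x :: 'a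
  have c0: "c n > 0" for n by (simp add: c_def)
  have Us: "U \<in> sets lebesgue" using U by auto
  have sq: "c n * (x \<bullet> x) = (real (Suc n) * norm x)\<^sup>2" for n and x :: 'a
    by (simp add: c_def power_mult_distrib power2_norm_eq_inner)
  have eta_bnd: "\<bar>\<eta> n x\<bar> \<le> 1" for n x
    using cutoff_range[of "c n * (x \<bullet> x)"] by (simp add: \<eta>_def)
  have eta'_0: "\<eta>' b n x = 0" if "real (Suc n) * norm x \<le> 1 \<or> real (Suc n) * norm x \<ge> 2" for b n x
  proof -
    have "c n * (x \<bullet> x) \<le> 1 \<or> c n * (x \<bullet> x) \<ge> 2"
    proof (cases "real (Suc n) * norm x \<le> 1")
      case True
      then show ?thesis unfolding sq using power_mono[of "real (Suc n) * norm x" 1 2] by simp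
    next
      case False
      then have "(2::real)\<^sup>2 \<le> (real (Suc n) * norm x)\<^sup>2" using that by (intro power_mono) auto
      then show ?thesis unfolding sq by simp
    qed
    then show ?thesis by (simp add: \<eta>'_def cutoff'_eq_0)
  qed
  \<comment> \<open>The constant is 4 from the derivative of \<open>cutoff\<close> times 4 from
    \<open>2 * c n * (x \<bullet> b)\<close>, which is at most \<open>4 (n + 1)\<close> in size
    while \<open>(n + 1) |x| < 2\<close>.\<close>
  have eta'_bnd: "\<bar>\<eta>' b n x\<bar> \<le> 16 * real (Suc n)" if b: "b \<in> Basis" for b n x
  proof (cases "real (Suc n) * norm x \<ge> 2")
    case False
    have "\<bar>x \<bullet> b\<bar> \<le> norm x" using Basis_le_norm[OF b] .
    then have "real (Suc n) * \<bar>x \<bullet> b\<bar> \<le> 2" using False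
      by (meson linear mult_left_mono of_nat_0_le_iff order_trans)
    then have "2 * real (Suc n) * (real (Suc n) * \<bar>x \<bullet> b\<bar>) \<le> 2 * real (Suc n) * 2"
      by (intro mult_left_mono) auto
    then have "\<bar>2 * c n * (x \<bullet> b)\<bar> \<le> 4 * real (Suc n)"
      using c0[of n] by (simp add: abs_mult c_def power2_eq_square mult_ac del: of_nat_Suc)
    with abs_cutoff'_le[of "c n * (x \<bullet> x)"]
    have "\<bar>cutoff' (c n * (x \<bullet> x))\<bar> * \<bar>2 * c n * (x \<bullet> b)\<bar> \<le> 4 * (4 * real (Suc n))"
      by (intro mult_mono) auto
    then show ?thesis by (simp add: \<eta>'_def abs_mult del: of_nat_Suc)
  qed (use eta'_0[of n x b] in simp)
  have eta_meas: "\<eta> n \<in> borel_measurable ?M" for n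
  proof -
    have "continuous_on UNIV (\<eta> n)" unfolding \<eta>_def[abs_def]
      by (rule continuous_on_compose2[OF continuous_on_cutoff[of UNIV]]) (auto intro!: continuous_intros)
    then show ?thesis
      by (intro measurable_restrict_space1 measurable_completion) (simp add: borel_measurable_continuous_onI)
  qed
  have eta'_meas: "\<eta>' b n \<in> borel_measurable ?M" for b n
  proof -
    have "continuous_on UNIV (\<lambda>x::'a. cutoff' (c n * (x \<bullet> x)))"
      by (rule continuous_on_compose2[OF continuous_on_cutoff'[of UNIV]]) (auto intro!: continuous_intros)
    then have "continuous_on UNIV (\<eta>' b n)"
      unfolding \<eta>'_def[abs_def] by (intro continuous_intros)
    then show ?thesis
      by (intro measurable_restrict_space1 measurable_completion) (simp add: borel_measurable_continuous_onI)
  qed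
  have eta_lim: "(\<lambda>n. \<eta> n x) \<longlonglongrightarrow> 1" if "x \<noteq> 0" for x
  proof (rule tendsto_eventually)
    obtain N where N: "real N > 2 / norm x" using reals_Archimedean2 by blast
    show "\<forall>\<^sub>F n in sequentially. \<eta> n x = 1"
    proof (rule eventually_sequentiallyI[of N])
      fix n assume "N \<le> n"
      then have "2 / norm x \<le> real (Suc n)" using N by simp
      then have "2 \<le> real (Suc n) * norm x" using that by (simp add: field_simps)
      then have "(2::real)\<^sup>2 \<le> c n * (x \<bullet> x)" unfolding sq by (intro power_mono) auto
      then show "\<eta> n x = 1" unfolding \<eta>_def by (intro cutoff_eq_1) simp
    qed
  qed
  have etaAE: "AE x in ?M. (\<lambda>n. \<eta> n x) \<longlonglongrightarrow> 1"
    using AE_lebesgue_on_neq[OF Us, of 0] by eventually_elim (rule eta_lim)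
  have conv: "(\<lambda>n. LINT x|?M. \<eta> n x * f x) \<longlonglongrightarrow> (LINT x|?M. f x)"
    and convi: "\<And>n. integrable ?M (\<lambda>x. \<eta> n x * f x)"
    if f: "integrable ?M f" for f
  proof -
    show "integrable ?M (\<lambda>x. \<eta> n x * f x)" for n
      by (rule integrable_bounded_mult[OF f eta_meas eta_bnd])
    show "(\<lambda>n. LINT x|?M. \<eta> n x * f x) \<longlonglongrightarrow> (LINT x|?M. f x)"
    proof (rule integral_dominated_convergence[where w = "\<lambda>x. \<bar>f x\<bar>"])
      show "AE x in ?M. (\<lambda>n. \<eta> n x * f x) \<longlonglongrightarrow> f x"
        using etaAE
      proof eventually_elim
        case (elim x)
        from tendsto_mult[OF this tendsto_const[of "f x"]] show ?case by simp
      qed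
      show "AE x in ?M. norm (\<eta> n x * f x) \<le> \<bar>f x\<bar>" for n
      proof (rule AE_I2)
        fix x show "norm (\<eta> n x * f x) \<le> \<bar>f x\<bar>"
          using mult_right_mono[OF eta_bnd, of "\<bar>f x\<bar>" n x] by (simp add: abs_mult)
      qed
    qed (use f eta_meas in auto)
  qed
  obtain M\<^sub>\<phi> where M0: "M\<^sub>\<phi> > 0" and M\<^sub>\<phi>: "\<And>x. \<bar>\<phi> x\<bar> \<le> M\<^sub>\<phi>"
    using test_function_bounded[OF \<phi>] by blast
  have Di: "integrable ?M (\<lambda>x. D x * \<phi> x)"
    using integrable_mult_test_function[OF Dint \<phi>] by (simp add: D_def)
  have Xi: "integrable ?M (\<lambda>x. X b x * partial_deriv b \<phi> x)" if "b \<in> Basis" for b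
    using integrable_mult_test_function[OF Xint[OF that] test_function_partial_deriv[OF \<phi> that]] .
  have Ei: "integrable ?M (\<lambda>x. \<eta>' b n x * (X b x * \<phi> x))" if "b \<in> Basis" for b n
    by (rule integrable_bounded_mult[OF integrable_mult_test_function[OF Xint[OF that] \<phi>] eta'_meas
          eta'_bnd[OF that]])
  \<comment> \<open>The components are added before the limit is taken, so that only their
    divergence \<open>D\<close> has to be integrable.\<close>
  have zero: "(LINT x|?M. \<eta> n x * (D x * \<phi> x))
      + (\<Sum>b\<in>Basis. LINT x|?M. \<eta> n x * (X b x * partial_deriv b \<phi> x))
      + (\<Sum>b\<in>Basis. LINT x|?M. \<eta>' b n x * (X b x * \<phi> x)) = 0" for n
  proof -
    define F where "F b x = \<eta> n x * \<phi> x * partial_deriv b (X b) x + \<eta> n x * partial_deriv b \<phi> x * X b x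
        + \<eta>' b n x * \<phi> x * X b x" for b x
    have F: "integrable ?M (F b)" "(LINT x|?M. F b x) = 0" if "b \<in> Basis" for b
      using integral_div_cutoff[OF U X[OF that] that \<phi> c0[of n]]
      by (simp_all add: F_def[abs_def] \<eta>_def \<eta>'_def)
    have "(\<Sum>b\<in>Basis. F b x) = \<eta> n x * (D x * \<phi> x)
        + (\<Sum>b\<in>Basis. \<eta> n x * (X b x * partial_deriv b \<phi> x))
        + (\<Sum>b\<in>Basis. \<eta>' b n x * (X b x * \<phi> x))" for x
      by (simp add: F_def D_def sum.distrib sum_distrib_left sum_distrib_right mult_ac)
    then have "(LINT x|?M. \<eta> n x * (D x * \<phi> x)
        + (\<Sum>b\<in>Basis. \<eta> n x * (X b x * partial_deriv b \<phi> x))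
        + (\<Sum>b\<in>Basis. \<eta>' b n x * (X b x * \<phi> x))) = (LINT x|?M. (\<Sum>b\<in>Basis. F b x))"
      by simp
    also have "\<dots> = 0" using F by (subst Bochner_Integration.integral_sum) auto
    finally show ?thesis
      using convi[OF Di, of n] convi[OF Xi, of _ n] Ei[of _ n]
      by (subst (asm) Bochner_Integration.integral_add, (intro Bochner_Integration.integrable_add
            Bochner_Integration.integrable_sum; simp), (intro Bochner_Integration.integrable_sum; simp))
        (subst (asm) Bochner_Integration.integral_add,
          simp, (intro Bochner_Integration.integrable_sum; simp), simp add: Bochner_Integration.integral_sum)
  qed
  have E: "(\<lambda>n. LINT x|?M. \<eta>' b n x * (X b x * \<phi> x)) \<longlonglongrightarrow> 0" if b: "b \<in> Basis" for b
  proof (rule LIMSEQ_I)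
    fix e :: real assume "e > 0"
    define V where "V = unit_ball_vol (real DIM('a)) * 2 ^ DIM('a)"
    have V0: "V \<ge> 0" by (simp add: V_def)
    \<comment> \<open>Chosen so that the final estimate \<open>16 * M\<^sub>\<phi> * V * d\<close>
      is below \<open>e\<close>; the added 1 makes the denominator positive and the inequality
      strict.\<close>
    define d where "d = e / (16 * M\<^sub>\<phi> * V + 1)"
    have den: "16 * M\<^sub>\<phi> * V + 1 > 0" using M0 V0 by (simp add: add_nonneg_pos)
    then have d: "d > 0" using \<open>e > 0\<close> by (simp add: d_def)
    have "16 * M\<^sub>\<phi> * V * d < (16 * M\<^sub>\<phi> * V + 1) * d" using d by (simp add: algebra_simps)
    also have "\<dots> = e" using den by (simp add: d_def)
    finally have de: "16 * M\<^sub>\<phi> * V * d < e" .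
    have "\<forall>\<^sub>F x in at 0. dist (X b x * norm x ^ (DIM('a) - 1)) 0 < d"
      using tendstoD[OF lim[OF b] d] .
    then obtain r where r: "r > 0"
      and rX: "\<And>x. x \<noteq> 0 \<Longrightarrow> norm x < r \<Longrightarrow> \<bar>X b x\<bar> * norm x ^ (DIM('a) - 1) < d"
      by (auto simp: eventually_at abs_mult)
    obtain n0 where n0: "real n0 > 2 / r" using reals_Archimedean2 by blast
    show "\<exists>n0. \<forall>n\<ge>n0. norm ((LINT x|?M. \<eta>' b n x * (X b x * \<phi> x)) - 0) < e"
    proof (intro exI allI impI)
      fix n assume n: "n0 \<le> n"
      define m where "m = real (Suc n)"
      have m: "m > 0" "2 / m < r"
      proof -
        show "m > 0" by (simp add: m_def)
        have "2 / r < m" using n n0 by (simp add: m_def)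
        then show "2 / m < r" using r \<open>m > 0\<close> by (simp add: field_simps)
      qed
      have bnd: "\<bar>\<eta>' b n x * (X b x * \<phi> x)\<bar> \<le> (16 * M\<^sub>\<phi> * d * m ^ DIM('a)) * indicator (ball 0 (2 / m)) x"
        for x
      proof (cases "m * norm x \<le> 1 \<or> m * norm x \<ge> 2")
        case True
        then have "\<eta>' b n x = 0" using eta'_0 by (simp add: m_def)
        then show ?thesis using M0 d m by (simp add: indicator_def)
      next
        case False
        then have x: "x \<noteq> 0" "norm x < 2 / m" "1 < m * norm x" using m(1) by (auto simp: field_simps)
        \<comment> \<open>On the layer \<open>m * norm x > 1\<close>, so inserting powers of it
          turns the smallness of \<open>X b x * norm x ^ (N - 1)\<close> into a bound on
          \<open>X b x\<close> itself.\<close>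
        have "\<bar>X b x\<bar> = \<bar>X b x\<bar> * 1" by simp
        also have "\<dots> \<le> \<bar>X b x\<bar> * (m * norm x) ^ (DIM('a) - 1)"
          using x by (intro mult_left_mono one_le_power) auto
        also have "\<dots> = \<bar>X b x\<bar> * norm x ^ (DIM('a) - 1) * m ^ (DIM('a) - 1)"
          by (simp add: power_mult_distrib)
        also have "\<dots> \<le> d * m ^ (DIM('a) - 1)"
          using rX[of x] x m by (intro mult_right_mono) auto
        finally have Xb: "\<bar>X b x\<bar> \<le> d * m ^ (DIM('a) - 1)" .
        have "\<bar>\<eta>' b n x\<bar> * (\<bar>X b x\<bar> * \<bar>\<phi> x\<bar>) \<le> (16 * m) * ((d * m ^ (DIM('a) - 1)) * M\<^sub>\<phi>)"
          using eta'_bnd[OF b, of n x] Xb M\<^sub>\<phi>[of x] m d by (intro mult_mono) (auto simp: m_def)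
        also have "\<dots> = 16 * M\<^sub>\<phi> * d * m ^ Suc (DIM('a) - 1)"
          by (simp only: power_Suc mult_ac)
        also have "Suc (DIM('a) - 1) = DIM('a)" by simp
        finally show ?thesis using x by (simp add: abs_mult)
      qed
      have "\<bar>LINT x|?M. \<eta>' b n x * (X b x * \<phi> x)\<bar>
          \<le> (16 * M\<^sub>\<phi> * d * m ^ DIM('a)) * (unit_ball_vol (DIM('a)) * (2 / m) ^ DIM('a))"
        by (rule integral_small_support_bound[OF Ei[OF b] U bnd]) (use M0 d m in auto)
      also have "\<dots> = 16 * M\<^sub>\<phi> * V * d" using m by (simp add: V_def power_divide)
      finally show "norm ((LINT x|?M. \<eta>' b n x * (X b x * \<phi> x)) - 0) < e" using de by simp
    qed
  qed
  have "(\<lambda>n. (LINT x|?M. \<eta> n x * (D x * \<phi> x))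
      + (\<Sum>b\<in>Basis. LINT x|?M. \<eta> n x * (X b x * partial_deriv b \<phi> x))
      + (\<Sum>b\<in>Basis. LINT x|?M. \<eta>' b n x * (X b x * \<phi> x))) \<longlonglongrightarrow>
      (LINT x|?M. D x * \<phi> x) + (\<Sum>b\<in>Basis. LINT x|?M. X b x * partial_deriv b \<phi> x)
      + (\<Sum>b\<in>(Basis::'a set). 0)"
    by (intro tendsto_add tendsto_sum conv Di Xi E) auto
  then have "(LINT x|?M. D x * \<phi> x) + (\<Sum>b\<in>Basis. LINT x|?M. X b x * partial_deriv b \<phi> x) = 0"
    unfolding zero using LIMSEQ_unique[OF _ tendsto_const[of "0::real"]] by simp
  then show ?thesis by (simp add: D_def)
qed

section \<open>Weak derivatives of functions with a point singularity\<close>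

lemma locally_integrableI:
  assumes "integrable (lebesgue_on U) f" "open U"
  shows "locally_integrable U f"
  unfolding locally_integrable_def
proof (intro allI impI, elim conjE)
  fix K assume K: "compact K" "K \<subseteq> U"
  have "set_integrable lebesgue U f"
    using assms by (simp add: integrable_restrict_space set_integrable_def)
  then have "set_integrable lebesgue K f"
    by (rule set_integrable_subset) (use K lmeasurable_compact in auto)
  then show "integrable (lebesgue_on K) f"
    using fmeasurableD[OF lmeasurable_compact[OF K(1)]]
    by (simp add: integrable_restrict_space set_integrable_def)
qed

text \<open>The arbitrary value at \<open>c\<close> is restored by adding a multiple of the
  indicator of a single point.\<close>

lemma borel_measurable_lebesgue_on_punctured:
  fixes f :: "'a::euclidean_space \<Rightarrow> real"
  assumes "open U" "continuous_on (U - {c}) f"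
  shows "f \<in> borel_measurable (lebesgue_on U)"
proof -
  have U: "U \<in> sets lebesgue" "U - {c} \<in> sets lebesgue"
    using assms(1) by auto
  have "f \<in> borel_measurable (lebesgue_on (U - {c}))"
    by (rule continuous_imp_measurable_on_sets_lebesgue[OF assms(2) U(2)])
  then have "(\<lambda>x. if x \<in> U - {c} then f x else 0) \<in> borel_measurable lebesgue"
    using borel_measurable_if[OF U(2)] by blast
  then have "(\<lambda>x. (if x \<in> U - {c} then f x else 0) + (if c \<in> U then f c else 0) * indicator {c} x)
      \<in> borel_measurable lebesgue"
    by (intro borel_measurable_add borel_measurable_times borel_measurable_indicator) auto
  also have "(\<lambda>x. (if x \<in> U - {c} then f x else 0) + (if c \<in> U then f c else 0) * indicator {c} x)
      = (\<lambda>x. if x \<in> U then f x else 0)"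
    by (auto simp: indicator_def)
  finally show ?thesis using borel_measurable_if[OF U(1)] by blast
qed

text \<open>The divergence identity for the field whose only nonzero component is \<open>u\<close>,
  in direction \<open>b\<close>.\<close>

lemma weak_partial_deriv_removable:
  fixes u :: "'a::euclidean_space \<Rightarrow> real"
  assumes U: "open U" and u: "Ck_on (Suc 0) (U - {0}) u" and uint: "integrable (lebesgue_on U) u"
    and lim: "((\<lambda>x. u x * norm x ^ (DIM('a) - 1)) \<longlongrightarrow> 0) (at 0)"
    and b: "b \<in> Basis" and Dint: "integrable (lebesgue_on U) (partial_deriv b u)"
    and \<phi>: "test_function U \<phi>"
  shows "(LINT x|lebesgue_on U. u x * partial_deriv b \<phi> x) =
    - (LINT x|lebesgue_on U. partial_deriv b u x * \<phi> x)"
proof -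
  define X where "X c = (if c = b then u else (\<lambda>x. 0))" for c
  have D: "(\<Sum>c\<in>Basis. partial_deriv c (X c) x) = partial_deriv b u x" for x
  proof -
    have "(\<Sum>c\<in>Basis. partial_deriv c (X c) x) = (\<Sum>c\<in>Basis. if c = b then partial_deriv b u x else 0)"
      by (rule sum.cong) (auto simp: X_def)
    then show ?thesis using b by simp
  qed
  have "(\<Sum>c\<in>Basis. LINT x|lebesgue_on U. X c x * partial_deriv c \<phi> x) =
    - (LINT x|lebesgue_on U. (\<Sum>c\<in>Basis. partial_deriv c (X c) x) * \<phi> x)"
  proof (rule divergence_removable_point[OF U _ _ _ _ \<phi>])
    show "Ck_on (Suc 0) (U - {0}) (X c)" for c using u Ck_on_const[of "Suc 0"] by (auto simp only: X_def split: if_splits)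
    show "integrable (lebesgue_on U) (X c)" for c using uint by (simp add: X_def)
    show "((\<lambda>x. X c x * norm x ^ (DIM('a) - 1)) \<longlongrightarrow> 0) (at 0)" for c using lim by (simp add: X_def)
    show "integrable (lebesgue_on U) (\<lambda>x. \<Sum>c\<in>Basis. partial_deriv c (X c) x)" using Dint by (simp add: D)
  qed
  moreover have "(\<Sum>c\<in>Basis. LINT x|lebesgue_on U. X c x * partial_deriv c \<phi> x) =
      (\<Sum>c\<in>Basis. if c = b then LINT x|lebesgue_on U. u x * partial_deriv b \<phi> x else 0)"
    by (rule sum.cong) (auto simp: X_def)
  ultimately show ?thesis using b by (simp add: D)
qed

text \<open>The derivatives leave the test function one at a time, the outermost first, and pile up
  in \<open>cs\<close>. The first one moved ends innermost on \<open>u\<close>, whence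
  \<open>rev bs\<close>; keeping this order avoids any appeal to the symmetry of mixed derivatives.
  The limit at the origin is used only for orders below \<open>k\<close>, those from which a
  derivative still moves over.\<close>

lemma weak_partial_derivs_removable:
  fixes u :: "'a::euclidean_space \<Rightarrow> real"
  assumes U: "open U" and u: "smooth_on (U - {0}) u"
    and int: "\<And>cs. set cs \<subseteq> Basis \<Longrightarrow> length cs \<le> k \<Longrightarrow> integrable (lebesgue_on U) (partial_derivs cs u)"
    and lim: "\<And>cs. set cs \<subseteq> Basis \<Longrightarrow> length cs < k \<Longrightarrow>
      ((\<lambda>x. partial_derivs cs u x * norm x ^ (DIM('a) - 1)) \<longlongrightarrow> 0) (at 0)"
    and \<phi>: "test_function U \<phi>"
    and bs: "set bs \<subseteq> Basis" and cs: "set cs \<subseteq> Basis" and len: "length bs + length cs \<le> k"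
  shows "(LINT x|lebesgue_on U. partial_derivs cs u x * partial_derivs bs \<phi> x) =
    (-1) ^ length bs * (LINT x|lebesgue_on U. partial_derivs (rev bs @ cs) u x * \<phi> x)"
  using bs cs len
proof (induction bs arbitrary: cs)
  case Nil
  then show ?case by simp
next
  case (Cons b bs)
  have "Ck_on (Suc 0) (U - {0}) (partial_derivs cs u)"
    using smooth_on_partial_derivs[OF u Cons.prems(2)] unfolding smooth_on_def by blast
  then have "(LINT x|lebesgue_on U. partial_derivs cs u x * partial_deriv b (partial_derivs bs \<phi>) x) =
      - (LINT x|lebesgue_on U. partial_deriv b (partial_derivs cs u) x * partial_derivs bs \<phi> x)"
    using Cons.prems int[of "b # cs"] \<phi>
    by (intro weak_partial_deriv_removable[OF U] int lim test_function_partial_derivs) auto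
  also have "\<dots> = - (LINT x|lebesgue_on U. partial_derivs (b # cs) u x * partial_derivs bs \<phi> x)"
    by simp
  also have "\<dots> = - ((-1) ^ length bs * (LINT x|lebesgue_on U. partial_derivs (rev bs @ b # cs) u x * \<phi> x))"
    using Cons.prems by (subst Cons.IH) auto
  finally show ?case by simp
qed

lemma weak_laplacian_removable:
  fixes u :: "'a::euclidean_space \<Rightarrow> real"
  assumes U: "open U" and u: "smooth_on (U - {0}) u"
    and int: "\<And>cs. set cs \<subseteq> Basis \<Longrightarrow> length cs \<le> 2 \<Longrightarrow> integrable (lebesgue_on U) (partial_derivs cs u)"
    and lim: "\<And>cs. set cs \<subseteq> Basis \<Longrightarrow> length cs < 2 \<Longrightarrow>
      ((\<lambda>x. partial_derivs cs u x * norm x ^ (DIM('a) - 1)) \<longlongrightarrow> 0) (at 0)"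
    and \<phi>: "test_function U \<phi>"
  shows "(LINT x|lebesgue_on U. u x * laplacian \<phi> x) = (LINT x|lebesgue_on U. laplacian u x * \<phi> x)"
proof -
  let ?M = "lebesgue_on U"
  have eq: "(LINT x|?M. u x * partial_deriv b (partial_deriv b \<phi>) x) =
      (LINT x|?M. partial_deriv b (partial_deriv b u) x * \<phi> x)" if "b \<in> Basis" for b
    using weak_partial_derivs_removable[OF U u int lim \<phi>, where bs = "[b, b]" and cs = "[]"] that
    by simp
  have "(LINT x|?M. u x * laplacian \<phi> x) = (\<Sum>b\<in>Basis. LINT x|?M. u x * partial_deriv b (partial_deriv b \<phi>) x)"
    unfolding laplacian_def sum_distrib_left
    by (rule Bochner_Integration.integral_sum)
      (use int[of "[]"] \<phi> in \<open>auto intro!: integrable_mult_test_function test_function_partial_deriv\<close>)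
  also have "\<dots> = (\<Sum>b\<in>Basis. LINT x|?M. partial_deriv b (partial_deriv b u) x * \<phi> x)"
    by (rule sum.cong) (auto simp: eq)
  also have "\<dots> = (LINT x|?M. laplacian u x * \<phi> x)"
    unfolding laplacian_def sum_distrib_right
  proof (rule Bochner_Integration.integral_sum[symmetric])
    fix b :: 'a assume "b \<in> Basis"
    then show "integrable ?M (\<lambda>x. partial_deriv b (partial_deriv b u) x * \<phi> x)"
      using int[of "[b, b]"] \<phi> by (auto intro!: integrable_mult_test_function)
  qed
  finally show ?thesis .
qed

text \<open>Only the full bilaplacian has to be integrable, not the individual fourth derivatives: the
  last integration by parts is applied to the vector field \<open>\<nabla>\<Delta>u\<close>.\<close>

lemma weak_bilaplacian_removable:
  fixes u :: "'a::euclidean_space \<Rightarrow> real"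
  assumes U: "open U" and u: "smooth_on (U - {0}) u"
    and int: "\<And>cs. set cs \<subseteq> Basis \<Longrightarrow> length cs \<le> 2 \<Longrightarrow> integrable (lebesgue_on U) (partial_derivs cs u)"
    and lim: "\<And>cs. set cs \<subseteq> Basis \<Longrightarrow> length cs < 2 \<Longrightarrow>
      ((\<lambda>x. partial_derivs cs u x * norm x ^ (DIM('a) - 1)) \<longlongrightarrow> 0) (at 0)"
    and lim2: "((\<lambda>x. laplacian u x * norm x ^ (DIM('a) - 1)) \<longlongrightarrow> 0) (at 0)"
    and int3: "\<And>b. b \<in> Basis \<Longrightarrow> integrable (lebesgue_on U) (partial_deriv b (laplacian u))"
    and lim3: "\<And>b. b \<in> Basis \<Longrightarrow>
      ((\<lambda>x. partial_deriv b (laplacian u) x * norm x ^ (DIM('a) - 1)) \<longlongrightarrow> 0) (at 0)"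
    and int4: "integrable (lebesgue_on U) (bilaplacian u)"
    and \<phi>: "test_function U \<phi>"
  shows "(LINT x|lebesgue_on U. u x * bilaplacian \<phi> x) = (LINT x|lebesgue_on U. bilaplacian u x * \<phi> x)"
proof -
  let ?M = "lebesgue_on U"
  let ?v = "laplacian u"
  have U': "open (U - {0})" using U by (rule open_delete)
  have v: "smooth_on (U - {0}) ?v" by (rule smooth_on_laplacian[OF U' u])
  have vint: "integrable ?M ?v"
    unfolding laplacian_def[abs_def]
  proof (rule Bochner_Integration.integrable_sum)
    fix b :: 'a assume "b \<in> Basis"
    then show "integrable ?M (partial_deriv b (partial_deriv b u))"
      using int[of "[b, b]"] by simp
  qed
  have Ck: "Ck_on (Suc 0) (U - {0}) ?v"
    and Ck': "\<And>b. b \<in> Basis \<Longrightarrow> Ck_on (Suc 0) (U - {0}) (partial_deriv b ?v)"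
    using v smooth_on_partial_deriv[OF v] unfolding smooth_on_def by blast+
  have bi: "(\<Sum>b\<in>Basis. partial_deriv b (partial_deriv b ?v) x) = bilaplacian u x" for x
    unfolding bilaplacian_def laplacian_def[of ?v] ..
  have "(LINT x|?M. u x * bilaplacian \<phi> x) = (LINT x|?M. ?v x * laplacian \<phi> x)"
    unfolding bilaplacian_def
    by (rule weak_laplacian_removable[OF U u int lim test_function_laplacian[OF \<phi>]])
  also have "\<dots> = (\<Sum>b\<in>Basis. LINT x|?M. ?v x * partial_deriv b (partial_deriv b \<phi>) x)"
    unfolding laplacian_def[of \<phi>] sum_distrib_left
    by (rule Bochner_Integration.integral_sum)
      (use vint \<phi> in \<open>auto intro!: integrable_mult_test_function test_function_partial_deriv\<close>)
  also have "\<dots> = (\<Sum>b\<in>Basis. - (LINT x|?M. partial_deriv b ?v x * partial_deriv b \<phi> x))"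
    by (intro sum.cong refl weak_partial_deriv_removable[OF U Ck vint lim2] int3
        test_function_partial_deriv \<phi>)
  also have "\<dots> = - (\<Sum>b\<in>Basis. LINT x|?M. partial_deriv b ?v x * partial_deriv b \<phi> x)"
    by (rule sum_negf)
  also have "\<dots> = (LINT x|?M. (\<Sum>b\<in>Basis. partial_deriv b (partial_deriv b ?v) x) * \<phi> x)"
    using int4 by (subst divergence_removable_point[OF U Ck' int3 lim3 _ \<phi>]) (simp_all add: bi)
  finally show ?thesis by (simp add: bi)
qed

section \<open>Radial functions\<close>

definition log_depth :: "'a::euclidean_space \<Rightarrow> real" where
  "log_depth x = - ln (norm x)"

lemma exp_minus_log_depth: "x \<noteq> 0 \<Longrightarrow> exp (- log_depth x) = norm x"
  by (simp add: log_depth_def)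

lemma exp_log_depth: "x \<noteq> 0 \<Longrightarrow> exp (log_depth x) = 1 / norm x"
  by (simp add: log_depth_def exp_minus inverse_eq_divide)

lemma log_depth_pos: "x \<noteq> 0 \<Longrightarrow> norm x < 1 \<Longrightarrow> log_depth x > 0"
  by (simp add: log_depth_def)

lemma log_depth_nonneg: "norm x \<le> 1 \<Longrightarrow> log_depth x \<ge> 0"
  by (cases "x = 0") (simp_all add: log_depth_def)

lemma filterlim_log_depth: "filterlim log_depth at_top (at (0::'a::euclidean_space))"
proof -
  have "filterlim (norm :: 'a \<Rightarrow> real) (at_right 0) (at 0)"
    unfolding filterlim_at by (auto intro!: tendsto_eq_intros simp: eventually_at_filter)
  from filterlim_compose[OF ln_at_0 this] show ?thesis
    unfolding log_depth_def[abs_def] by (simp add: filterlim_uminus_at_top)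
qed

text \<open>A substitute for polar coordinates. Where \<open>log_depth x\<close> lies in
  \<open>[n, n + 1)\<close> the function is at most \<open>exp (N (n + 1)) * H n\<close>, and the
  ball of radius \<open>exp (- n)\<close> containing this shell has volume
  \<open>V * exp (- N n)\<close>. The exponentials cancel up to \<open>exp N\<close>, so the
  integral is at most a constant times the sum of the \<open>H n\<close>. No power of
  \<open>|x|\<close> is lost, which the borderline singularity
  \<open>|x|^(-4) t^(\<gamma> - 2)\<close> demands.\<close>

lemma integrable_on_unit_ball_shells:
  fixes f :: "'a::euclidean_space \<Rightarrow> real"
  assumes meas: "f \<in> borel_measurable (lebesgue_on (ball 0 1))"
    and bnd: "\<And>x. x \<noteq> 0 \<Longrightarrow> norm x < 1 \<Longrightarrow> \<bar>f x\<bar> \<le> exp (real DIM('a) * log_depth x) * H (log_depth x)"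
    and mono: "\<And>s t. 0 \<le> s \<Longrightarrow> s \<le> t \<Longrightarrow> H t \<le> H s"
    and nonneg: "\<And>t. 0 \<le> t \<Longrightarrow> 0 \<le> H t"
    and summ: "summable (\<lambda>n. H (real n))"
  shows "integrable (lebesgue_on (ball 0 1)) f"
proof (rule integrableI_bounded[OF meas])
  define N where "N = real DIM('a)"
  define c where "c n = exp (N * real (Suc n)) * H (real n)" for n
  define V where "V = unit_ball_vol N"
  have V0: "V \<ge> 0" by (simp add: V_def N_def)
  have c0: "c n \<ge> 0" for n by (simp add: c_def nonneg)
  have pt: "ennreal (norm (f x)) \<le> (\<Sum>n. ennreal (c n) * indicator (cball 0 (exp (- real n))) x)"
    if x: "x \<noteq> 0" "norm x < 1" for x
  proof -
    define n where "n = nat \<lfloor>log_depth x\<rfloor>"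
    have pos: "log_depth x > 0" using log_depth_pos[OF x] .
    have n: "real n \<le> log_depth x" "log_depth x \<le> real (Suc n)"
      using pos by (simp_all add: n_def) linarith+
    have "\<bar>f x\<bar> \<le> exp (N * log_depth x) * H (log_depth x)" using bnd[OF x] by (simp add: N_def)
    also have "\<dots> \<le> exp (N * real (Suc n)) * H (real n)"
      using n pos by (intro mult_mono mono nonneg) (auto simp: N_def simp del: of_nat_Suc intro!: mult_left_mono)
    finally have 1: "\<bar>f x\<bar> \<le> c n" by (simp add: c_def)
    have "norm x = exp (- log_depth x)" using exp_minus_log_depth[OF x(1)] by simp
    also have "\<dots> \<le> exp (- real n)" using n by simp
    finally have "norm x \<le> exp (- real n)" .
    then have "ennreal (norm (f x)) \<le> ennreal (c n) * indicator (cball 0 (exp (- real n))) x"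
      using 1 by (simp add: ennreal_leI)
    also have "\<dots> = (\<Sum>n\<in>{n}. ennreal (c n) * indicator (cball 0 (exp (- real n))) x)"
      by (subst sum.insert) (simp_all only: finite.emptyI empty_iff not_False_eq_True sum.empty add_0_right)
    also have "\<dots> \<le> (\<Sum>n. ennreal (c n) * indicator (cball 0 (exp (- real n))) x)"
      by (rule sum_le_suminf) auto
    finally show ?thesis .
  qed
  have B: "ball (0::'a) 1 \<in> sets lebesgue" by auto
  have ci: "exp (N * real (Suc n)) * exp (- real n) ^ DIM('a) = exp N" for n
    by (simp add: N_def exp_of_nat_mult[symmetric] exp_add[symmetric] algebra_simps)
  have "(\<integral>\<^sup>+ x. ennreal (norm (f x)) \<partial>lebesgue_on (ball 0 1))
      \<le> (\<integral>\<^sup>+ x. (\<Sum>n. ennreal (c n) * indicator (cball 0 (exp (- real n))) (x::'a)) \<partial>lebesgue_on (ball 0 1))"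
  proof (rule nn_integral_mono_AE)
    show "AE x in lebesgue_on (ball 0 1). ennreal (norm (f x))
        \<le> (\<Sum>n. ennreal (c n) * indicator (cball 0 (exp (- real n))) x)"
      using AE_lebesgue_on_neq[OF B, of 0] AE_space
      by eventually_elim (rule pt, auto)
  qed
  also have "\<dots> \<le> (\<integral>\<^sup>+ x. (\<Sum>n. ennreal (c n) * indicator (cball 0 (exp (- real n))) (x::'a)) \<partial>lebesgue)"
    using B by (subst nn_integral_restrict_space) (auto intro!: nn_integral_mono simp: indicator_def)
  also have "\<dots> = (\<Sum>n. \<integral>\<^sup>+ x. ennreal (c n) * indicator (cball 0 (exp (- real n))) (x::'a) \<partial>lebesgue)"
    by (intro nn_integral_suminf borel_measurable_times_ennreal borel_measurable_indicator) auto
  also have "\<dots> = (\<Sum>n. ennreal (c n) * emeasure lebesgue (cball (0::'a) (exp (- real n))))"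
    by (simp add: nn_integral_cmult_indicator)
  also have "\<dots> = (\<Sum>n. ennreal (V * exp N * H (real n)))"
  proof (rule suminf_cong)
    fix n
    have "emeasure lebesgue (cball (0::'a) (exp (- real n))) = ennreal (V * exp (- real n) ^ DIM('a))"
      using emeasure_cball[of "exp (- real n)" "0::'a"] by (simp add: V_def N_def)
    then have "ennreal (c n) * emeasure lebesgue (cball (0::'a) (exp (- real n)))
        = ennreal (c n * (V * exp (- real n) ^ DIM('a)))"
      using c0 V0 by (simp add: ennreal_mult)
    also have "c n * (V * exp (- real n) ^ DIM('a))
        = V * (exp (N * real (Suc n)) * exp (- real n) ^ DIM('a)) * H (real n)"
      by (simp only: c_def mult_ac)
    finally show "ennreal (c n) * emeasure lebesgue (cball (0::'a) (exp (- real n)))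
        = ennreal (V * exp N * H (real n))" by (simp only: ci)
  qed
  also have "\<dots> < \<infinity>"
    using summ V0 nonneg by (subst suminf_ennreal2) (auto intro!: summable_mult mult_nonneg_nonneg)
  finally show "(\<integral>\<^sup>+ x. ennreal (norm (f x)) \<partial>lebesgue_on (ball 0 1)) < \<infinity>" .
qed

lemma has_derivative_log_depth:
  assumes "x \<noteq> 0"
  shows "(log_depth has_derivative (\<lambda>h. - exp (2 * log_depth x) * (x \<bullet> h))) (at x)"
proof -
  have e: "exp (2 * log_depth x) = 1 / (x \<bullet> x)"
    using exp_log_depth[OF assms]
    by (simp add: exp_double power_divide power2_norm_eq_inner)
  have "((\<lambda>x. - (ln (x \<bullet> x) / 2)) has_derivative (\<lambda>h. - exp (2 * log_depth x) * (x \<bullet> h))) (at x)"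
    unfolding e using assms
    by (auto intro!: derivative_eq_intros simp: inner_commute field_simps)
  \<comment> \<open>The identity includes the origin, where both sides are 0 because
    \<open>ln 0 = 0\<close>.\<close>
  moreover have "log_depth = (\<lambda>x::'a. - (ln (x \<bullet> x) / 2))"
  proof
    fix y :: 'a
    show "log_depth y = - (ln (y \<bullet> y) / 2)"
      by (cases "y = 0") (simp_all add: log_depth_def power2_norm_eq_inner[symmetric] ln_realpow)
  qed
  ultimately show ?thesis by simp
qed

lemma smooth_on_log_depth: "smooth_on (- {0}) (log_depth :: 'a::euclidean_space \<Rightarrow> real)"
proof -
  have o: "open (- {0::'a})" by (intro open_Compl) simp
  have "smooth_on (- {0}) (\<lambda>x::'a. \<Sum>b\<in>Basis. (x \<bullet> b) * (x \<bullet> b))"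
    by (intro smooth_on_sum smooth_on_mult o smooth_on_inner finite_Basis)
  then have "smooth_on (- {0}) (\<lambda>x::'a. x \<bullet> x)"
    by (subst euclidean_inner)
  then have "smooth_on (- {0}) (\<lambda>x::'a. ln (x \<bullet> x))"
    by (rule smooth_on_compose[OF o smooth_on_ln]) auto
  then have "smooth_on (- {0}) (\<lambda>x::'a. (- 1 / 2) * ln (x \<bullet> x))"
    by (intro smooth_on_mult o smooth_on_const)
  moreover have "log_depth x = (- 1 / 2) * ln (x \<bullet> x)" if "x \<in> - {0}" for x :: 'a
    using that by (simp add: log_depth_def power2_norm_eq_inner[symmetric] ln_realpow)
  ultimately show ?thesis by (subst smooth_on_cong[OF o])
qed

text \<open>Since \<open>\<nabla>(G \<circ> log_depth) = - e\<^bsup>2t\<^esup> G'(t) x\<close> at \<open>t = log_depth x\<close>, it is convenient to write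
  the derivative of a radial profile as \<open>G' = - e\<^bsup>-2t\<^esup> G\<^sub>1\<close>.\<close>

definition radial_deriv :: "real \<Rightarrow> (real \<Rightarrow> real) \<Rightarrow> (real \<Rightarrow> real) \<Rightarrow> bool" where
  "radial_deriv l G G1 \<longleftrightarrow> (\<forall>t>l. (G has_real_derivative - exp (- 2 * t) * G1 t) (at t))"

text \<open>The punctured open ball of radius \<open>exp (- l)\<close>. A negative \<open>l\<close>
  gives an open set containing the punctured closed unit ball, which is what smoothness up to the
  boundary asks for.\<close>

definition depth_domain :: "real \<Rightarrow> 'a::euclidean_space set" where
  "depth_domain l = {x. x \<noteq> 0 \<and> log_depth x > l}"

lemma open_depth_domain: "open (depth_domain l)"
proof -
  have "depth_domain l = ball (0::'a) (exp (- l)) - {0}"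
  proof (rule set_eqI)
    fix x :: 'a
    have "ln (norm x) < - l \<longleftrightarrow> norm x < exp (- l)" if "x \<noteq> 0"
      using that by (metis exp_less_cancel_iff exp_ln zero_less_norm_iff)
    then show "x \<in> depth_domain l \<longleftrightarrow> x \<in> ball (0::'a) (exp (- l)) - {0}"
      by (cases "x = 0") (auto simp: depth_domain_def log_depth_def)
  qed
  then show ?thesis by (simp add: open_delete)
qed

lemma cball_subset_depth_domain:
  assumes "l < 0"
  shows "cball 0 1 - {0} \<subseteq> depth_domain l"
proof
  fix x :: 'a assume "x \<in> cball 0 1 - {0}"
  then show "x \<in> depth_domain l"
    using assms log_depth_nonneg[of x] by (simp add: depth_domain_def)
qed

lemma has_derivative_radial:
  assumes "radial_deriv l G G1" "x \<in> depth_domain l"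
  shows "((\<lambda>x. G (log_depth x)) has_derivative (\<lambda>h. (x \<bullet> h) * G1 (log_depth x))) (at x)"
proof -
  let ?t = "log_depth x"
  have x: "x \<noteq> 0" "?t > l" using assms(2) by (auto simp: depth_domain_def)
  have "(G has_derivative (*) (- exp (- 2 * ?t) * G1 ?t)) (at ?t)"
    using assms(1) x(2) by (simp add: radial_deriv_def has_field_derivative_def)
  from has_derivative_compose[OF has_derivative_log_depth[OF x(1)] this]
  have "((\<lambda>x. G (log_depth x)) has_derivative
      (\<lambda>h. (exp (- 2 * ?t) * exp (2 * ?t)) * ((x \<bullet> h) * G1 ?t))) (at x)"
    by (simp add: mult_ac)
  also have "exp (- 2 * ?t) * exp (2 * ?t) = 1" by (simp add: exp_add[symmetric])
  finally show ?thesis by simp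
qed

lemma partial_deriv_radial:
  assumes "radial_deriv l G G1" "x \<in> depth_domain l"
  shows "partial_deriv b (\<lambda>x. G (log_depth x)) x = (x \<bullet> b) * G1 (log_depth x)"
  using partial_deriv_eq[OF has_derivative_radial[OF assms]] .

lemma partial_deriv2_radial:
  assumes G: "radial_deriv l G G1" "radial_deriv l G1 G2" and x: "x \<in> depth_domain l"
  shows "partial_deriv c (partial_deriv b (\<lambda>x. G (log_depth x))) x =
    (b \<bullet> c) * G1 (log_depth x) + (x \<bullet> b) * (x \<bullet> c) * G2 (log_depth x)"
proof -
  have "partial_deriv c (partial_deriv b (\<lambda>x. G (log_depth x))) x =
      partial_deriv c (\<lambda>x. (x \<bullet> b) * G1 (log_depth x)) x"
    by (rule partial_deriv_cong[OF open_depth_domain x partial_deriv_radial[OF G(1)]])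
  also have "\<dots> = (c \<bullet> b) * G1 (log_depth x) + (x \<bullet> b) * ((x \<bullet> c) * G2 (log_depth x))"
    by (rule partial_deriv_eq) (auto intro!: derivative_eq_intros has_derivative_radial[OF G(2) x])
  finally show ?thesis by (simp add: inner_commute)
qed

lemma partial_deriv3_radial:
  assumes G: "radial_deriv l G G1" "radial_deriv l G1 G2" "radial_deriv l G2 G3"
    and x: "x \<in> depth_domain l"
  shows "partial_deriv d (partial_deriv c (partial_deriv b (\<lambda>x. G (log_depth x)))) x =
    ((b \<bullet> c) * (x \<bullet> d) + (d \<bullet> b) * (x \<bullet> c) + (x \<bullet> b) * (d \<bullet> c)) * G2 (log_depth x)
    + (x \<bullet> b) * (x \<bullet> c) * (x \<bullet> d) * G3 (log_depth x)"
proof -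
  have "partial_deriv d (partial_deriv c (partial_deriv b (\<lambda>x. G (log_depth x)))) x =
      partial_deriv d (\<lambda>x. (b \<bullet> c) * G1 (log_depth x) + (x \<bullet> b) * (x \<bullet> c) * G2 (log_depth x)) x"
    by (rule partial_deriv_cong[OF open_depth_domain x partial_deriv2_radial[OF G(1,2)]])
  also have "\<dots> = (b \<bullet> c) * ((x \<bullet> d) * G2 (log_depth x))
      + (((d \<bullet> b) * (x \<bullet> c) + (x \<bullet> b) * (d \<bullet> c)) * G2 (log_depth x)
         + (x \<bullet> b) * (x \<bullet> c) * ((x \<bullet> d) * G3 (log_depth x)))"
    by (rule partial_deriv_eq)
      (auto intro!: derivative_eq_intros has_derivative_radial[OF G(2) x] has_derivative_radial[OF G(3) x]
        simp: algebra_simps)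
  finally show ?thesis by (simp add: algebra_simps)
qed

lemma laplacian_radial:
  fixes x :: "'a::euclidean_space"
  assumes G: "radial_deriv l G G1" "radial_deriv l G1 G2" and x: "x \<in> depth_domain l"
  shows "laplacian (\<lambda>x. G (log_depth x)) x =
    real DIM('a) * G1 (log_depth x) + exp (- 2 * log_depth x) * G2 (log_depth x)"
proof -
  have "laplacian (\<lambda>x. G (log_depth x)) x =
      (\<Sum>b\<in>(Basis::'a set). (b \<bullet> b) * G1 (log_depth x)) + (\<Sum>b\<in>Basis. (x \<bullet> b) * (x \<bullet> b)) * G2 (log_depth x)"
    by (simp add: laplacian_def partial_deriv2_radial[OF G x] sum.distrib sum_distrib_right)
  also have "(\<Sum>b\<in>(Basis::'a set). (b \<bullet> b) * G1 (log_depth x)) = real DIM('a) * G1 (log_depth x)"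
    by simp
  also have "(\<Sum>b\<in>Basis. (x \<bullet> b) * (x \<bullet> b)) = x \<bullet> x"
    by (rule euclidean_inner[symmetric])
  also have "x \<bullet> x = (exp (- log_depth x))\<^sup>2"
    using x exp_minus_log_depth[of x] by (simp add: depth_domain_def power2_norm_eq_inner)
  also have "\<dots> = exp (- 2 * log_depth x)" by (simp add: exp_double[symmetric])
  finally show ?thesis .
qed

section \<open>Power singularities in the unit ball of dimension 4\<close>

lemma integrable_on_unit_ball_powr_bound:
  fixes f :: "real^4 \<Rightarrow> real"
  assumes meas: "f \<in> borel_measurable (lebesgue_on (ball 0 1))"
    and bnd: "\<And>x. x \<noteq> 0 \<Longrightarrow> norm x < 1 \<Longrightarrow> \<bar>f x\<bar> \<le> C * exp (q * log_depth x)"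
    and q: "q < 4"
  shows "integrable (lebesgue_on (ball 0 1)) f"
proof (rule integrable_on_unit_ball_shells[OF meas, where H = "\<lambda>t. \<bar>C\<bar> * exp (- (4 - q) * t)"])
  fix x :: "real^4" assume x: "x \<noteq> 0" "norm x < 1"
  have "\<bar>f x\<bar> \<le> \<bar>C\<bar> * exp (q * log_depth x)"
    using bnd[OF x] mult_right_mono[OF abs_ge_self[of C] exp_ge_zero] by (rule order_trans)
  also have "exp (q * log_depth x) = exp (4 * log_depth x) * exp (- (4 - q) * log_depth x)"
    by (simp add: exp_add[symmetric] algebra_simps)
  finally show "\<bar>f x\<bar> \<le> exp (real DIM(real^4) * log_depth x) * (\<bar>C\<bar> * exp (- (4 - q) * log_depth x))"
    by (simp add: mult_ac)
next
  fix s t :: real assume "0 \<le> s" "s \<le> t"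
  then have "- (4 - q) * t \<le> - (4 - q) * s" using q by (intro mult_left_mono_neg) auto
  then show "\<bar>C\<bar> * exp (- (4 - q) * t) \<le> \<bar>C\<bar> * exp (- (4 - q) * s)"
    by (intro mult_left_mono) auto
next
  have "summable (\<lambda>n. exp (- (4 - q)) ^ n)" using q by (intro summable_geometric) simp
  moreover have "exp (- (4 - q)) ^ n = exp (- (4 - q) * real n)" for n
    by (simp add: exp_of_nat2_mult)
  ultimately show "summable (\<lambda>n. \<bar>C\<bar> * exp (- (4 - q) * real n))"
    by (intro summable_mult) (simp only:)
qed auto

text \<open>The \<open>p\<close>-th power of \<open>|x|^(-3)\<close> is \<open>|x|^(-3 p)\<close>,
  and \<open>3 p < 4\<close> is exactly \<open>p < 4/3\<close>.\<close>

lemma in_Lp_unit_ball_cube_bound: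
  fixes f :: "real^4 \<Rightarrow> real"
  assumes meas: "f \<in> borel_measurable (lebesgue_on (ball 0 1))"
    and bnd: "\<And>x. x \<noteq> 0 \<Longrightarrow> norm x < 1 \<Longrightarrow> \<bar>f x\<bar> \<le> C * exp (3 * log_depth x)"
    and p: "0 < p" "p < 4 / 3"
  shows "in_Lp p (ball 0 1) f"
  unfolding in_Lp_def
proof
  show "integrable (lebesgue_on (ball 0 1)) (\<lambda>x. \<bar>f x\<bar> powr p)"
  proof (rule integrable_on_unit_ball_powr_bound)
    show "(\<lambda>x. \<bar>f x\<bar> powr p) \<in> borel_measurable (lebesgue_on (ball 0 1))" using meas by simp
    show "3 * p < 4" using p by simp
    fix x :: "real^4" assume x: "x \<noteq> 0" "norm x < 1"
    have C0: "0 \<le> C * exp (3 * log_depth x)" using bnd[OF x] by linarith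
    then have "C \<ge> 0" by (simp add: zero_le_mult_iff)
    have "\<bar>f x\<bar> powr p \<le> (C * exp (3 * log_depth x)) powr p"
      using bnd[OF x] p by (intro powr_mono2) auto
    also have "\<dots> = C powr p * exp (3 * p * log_depth x)"
      using \<open>C \<ge> 0\<close> by (simp add: powr_mult exp_powr_real mult_ac)
    finally show "\<bar>\<bar>f x\<bar> powr p\<bar> \<le> C powr p * exp (3 * p * log_depth x)" by simp
  qed
qed (rule meas)

section \<open>Functions of \<open>log_depth\<close> with a slowly growing profile\<close>

lemma radial_derivI:
  assumes "\<And>t. t > l \<Longrightarrow> (G has_real_derivative d t) (at t)" "\<And>t. t > l \<Longrightarrow> G1 t = - exp (2 * t) * d t"
  shows "radial_deriv l G G1"
proof -
  have "- exp (- 2 * t) * (- exp (2 * t) * y) = y" for t y :: real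
    by (simp add: exp_minus field_simps)
  then show ?thesis unfolding radial_deriv_def using assms by metis
qed

text \<open>The profile is given on \<open>t > -1\<close>, hence beyond the unit sphere
  \<open>t = 0\<close>. \<open>growth\<close> and \<open>bound\<close> control the derivatives of
  \<open>w\<close> up to order 3 by powers of \<open>1/|x|\<close>; \<open>tends\<close> is the
  extra decay that kills the flux of the gradient of the Laplacian at the origin; \<open>H\<close>
  is a decreasing summable majorant of \<open>|x|^4\<close> times the bilaplacian.\<close>

locale radial_profile =
  fixes f f1 f2 f3 f4 H :: "real \<Rightarrow> real" and B :: real
  assumes deriv: "\<And>t. t > -1 \<Longrightarrow> (f has_real_derivative f1 t) (at t)"
      "\<And>t. t > -1 \<Longrightarrow> (f1 has_real_derivative f2 t) (at t)"
      "\<And>t. t > -1 \<Longrightarrow> (f2 has_real_derivative f3 t) (at t)"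
      "\<And>t. t > -1 \<Longrightarrow> (f3 has_real_derivative f4 t) (at t)"
    and smooth: "smooth_on {-1<..} f"
    and growth: "\<And>t. t \<ge> 0 \<Longrightarrow> \<bar>f t\<bar> \<le> B * exp t"
    and bound: "\<And>t. t \<ge> 0 \<Longrightarrow> \<bar>f1 t\<bar> \<le> B" "\<And>t. t \<ge> 0 \<Longrightarrow> \<bar>f2 t\<bar> \<le> B" "\<And>t. t \<ge> 0 \<Longrightarrow> \<bar>f3 t\<bar> \<le> B"
    and tends: "(f1 \<longlongrightarrow> 0) at_top" "(f3 \<longlongrightarrow> 0) at_top"
    and H: "\<And>t. t \<ge> 0 \<Longrightarrow> \<bar>f4 t - 4 * f2 t\<bar> \<le> H t"
      "\<And>s t. 0 \<le> s \<Longrightarrow> s \<le> t \<Longrightarrow> H t \<le> H s" "summable (\<lambda>n. H (real n))"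
begin

definition w :: "real^4 \<Rightarrow> real" where "w x = f (log_depth x)"

text \<open>\<open>G1\<close>, \<open>G2\<close>, \<open>G3\<close> are the iterated derivatives of
  \<open>f\<close> in the sense of \<open>radial_deriv\<close>. \<open>h0\<close> is the profile of
  the Laplacian of \<open>w\<close>, and \<open>h1\<close>, \<open>h2\<close> are its iterated
  derivatives in the same sense.\<close>

definition G1 :: "real \<Rightarrow> real" where "G1 t = - exp (2 * t) * f1 t"
definition G2 :: "real \<Rightarrow> real" where "G2 t = exp (2 * t) ^ 2 * (2 * f1 t + f2 t)"
definition G3 :: "real \<Rightarrow> real" where "G3 t = - (exp (2 * t) ^ 3) * (8 * f1 t + 6 * f2 t + f3 t)"
definition h0 :: "real \<Rightarrow> real" where "h0 t = exp (2 * t) * (f2 t - 2 * f1 t)"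
definition h1 :: "real \<Rightarrow> real" where "h1 t = exp (2 * t) ^ 2 * (4 * f1 t - f3 t)"
definition h2 :: "real \<Rightarrow> real" where "h2 t = exp (2 * t) ^ 3 * (4 * f3 t - 16 * f1 t + f4 t - 4 * f2 t)"

lemma radial_derivs:
  "radial_deriv (-1) f G1" "radial_deriv (-1) G1 G2" "radial_deriv (-1) G2 G3"
  "radial_deriv (-1) h0 h1" "radial_deriv (-1) h1 h2"
proof -
  note d = derivative_eq_intros deriv
  show "radial_deriv (-1) f G1"
    by (rule radial_derivI[OF deriv(1)]) (simp_all add: G1_def)
  show "radial_deriv (-1) G1 G2"
    by (rule radial_derivI[where d = "\<lambda>t. - (exp (2 * t) * (2 * f1 t + f2 t))"])
      (auto intro!: d simp: G1_def[abs_def] G2_def algebra_simps power2_eq_square)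
  show "radial_deriv (-1) G2 G3"
    by (rule radial_derivI[where d = "\<lambda>t. exp (2 * t) ^ 2 * (8 * f1 t + 6 * f2 t + f3 t)"])
      (auto intro!: d simp: G2_def[abs_def] G3_def algebra_simps power2_eq_square power3_eq_cube)
  show "radial_deriv (-1) h0 h1"
    by (rule radial_derivI[where d = "\<lambda>t. exp (2 * t) * (f3 t - 4 * f1 t)"])
      (auto intro!: d simp: h0_def[abs_def] h1_def algebra_simps power2_eq_square)
  show "radial_deriv (-1) h1 h2"
    by (rule radial_derivI[where d = "\<lambda>t. - (exp (2 * t) ^ 2 * (4 * f3 t - 16 * f1 t + f4 t - 4 * f2 t))"])
      (auto intro!: d simp: h1_def[abs_def] h2_def algebra_simps power2_eq_square power3_eq_cube)
qed

abbreviation V :: "(real^4) set" where "V \<equiv> depth_domain (-1)"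

lemma smooth_w: "smooth_on V w"
  unfolding w_def[abs_def]
proof (rule smooth_on_compose[OF open_depth_domain smooth])
  show "smooth_on V log_depth"
    by (rule smooth_on_subset[OF smooth_on_log_depth]) (auto simp: depth_domain_def)
qed (auto simp: depth_domain_def)

lemma ball_subset_V: "ball 0 1 - {0} \<subseteq> V"
  using cball_subset_depth_domain[of "-1", where 'a = "real^4"] ball_subset_cball[of "0::real^4" 1]
  by (simp add: subset_eq)

lemma smooth_w_ball: "smooth_on (ball 0 1 - {0}) w"
  using smooth_on_subset[OF smooth_w ball_subset_V] .

lemma inner_Basis_le:
  fixes x :: "real^4"
  assumes "x \<noteq> 0" "b \<in> Basis"
  shows "\<bar>x \<bullet> b\<bar> \<le> exp (- log_depth x)"
  using Basis_le_norm[OF assms(2), of x] exp_minus_log_depth[OF assms(1)] by simp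

lemma B_nonneg: "B \<ge> 0"
  using bound(1)[of 0] by simp

lemma abs_inner_Basis_le_1: "b \<in> Basis \<Longrightarrow> c \<in> Basis \<Longrightarrow> \<bar>(b::real^4) \<bullet> c\<bar> \<le> 1"
  by (simp add: inner_Basis)

lemma laplacian_w:
  assumes x: "x \<in> V"
  shows "laplacian w x = h0 (log_depth x)"
proof -
  have "laplacian w x = 4 * G1 (log_depth x) + exp (- 2 * log_depth x) * G2 (log_depth x)"
    using laplacian_radial[OF radial_derivs(1,2) x] by (simp add: w_def[abs_def])
  also have "exp (- 2 * t) * G2 t = exp (2 * t) * (2 * f1 t + f2 t)" for t
    by (simp add: G2_def exp_minus power2_eq_square field_simps)
  finally show ?thesis by (simp add: G1_def h0_def algebra_simps)
qed

text \<open>Dimension 4 makes the odd derivatives cancel: \<open>4 h1\<close> contributes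
  \<open>16 f1 - 4 f3\<close>, and the term with \<open>h2\<close> contributes the opposite. The
  exponents annihilated by \<open>f4 - 4 f2\<close> are 0 (twice) and 2, -2, that is, the radial
  biharmonic functions 1, \<open>ln |x|\<close>, \<open>|x|^(-2)\<close> and
  \<open>|x|^2\<close>.\<close>

lemma bilaplacian_w:
  assumes x: "x \<in> V"
  shows "bilaplacian w x = exp (4 * log_depth x) * (f4 (log_depth x) - 4 * f2 (log_depth x))"
proof -
  have "bilaplacian w x = laplacian (\<lambda>x::real^4. h0 (log_depth x)) x"
    unfolding bilaplacian_def laplacian_def[of "laplacian w"] laplacian_def[of "\<lambda>x. h0 (log_depth x)"]
    by (intro sum.cong refl partial_deriv_cong[OF open_depth_domain x])
      (rule partial_deriv_cong[OF open_depth_domain _ laplacian_w])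
  also have "\<dots> = 4 * h1 (log_depth x) + exp (- 2 * log_depth x) * h2 (log_depth x)"
    using laplacian_radial[OF radial_derivs(4,5) x] by simp
  also have "exp (- 2 * t) * h2 t = exp (2 * t) ^ 2 * (4 * f3 t - 16 * f1 t + f4 t - 4 * f2 t)" for t
    by (simp add: h2_def exp_minus power2_eq_square power3_eq_cube field_simps)
  finally have "bilaplacian w x = exp (2 * log_depth x) ^ 2 * (f4 (log_depth x) - 4 * f2 (log_depth x))"
    by (simp add: h1_def algebra_simps)
  then show ?thesis by (simp add: exp_double[symmetric])
qed

lemma partial_deriv_laplacian_w:
  assumes x: "x \<in> V"
  shows "partial_deriv b (laplacian w) x = (x \<bullet> b) * h1 (log_depth x)"
  using partial_deriv_cong[OF open_depth_domain x laplacian_w] partial_deriv_radial[OF radial_derivs(4) x]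
  by simp

text \<open>Derivatives in \<open>t\<close> are bounded, and each derivative in \<open>x\<close>
  costs one factor \<open>1/|x|\<close>. For order 0 only the bound \<open>B / |x|\<close> is
  available, whence the \<open>max 1\<close>. The constant is set by order 3: three mixed terms with
  \<open>3 B\<close> each give 9, and \<open>8 + 6 + 1 = 15\<close> comes from
  \<open>G3\<close>.\<close>

lemma partial_derivs_w_bound:
  assumes cs: "set cs \<subseteq> Basis" "length cs \<le> 3" and x: "x \<noteq> 0" "norm x < 1"
  shows "\<bar>partial_derivs cs w x\<bar> \<le> 24 * B * exp (real (max 1 (length cs)) * log_depth x)"
proof -
  define t where "t = log_depth x"
  define r where "r = exp (- t)"
  define E where "E = exp (2 * t)"
  have t: "t \<ge> 0" using log_depth_pos[OF x] by (simp add: t_def)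
  have xV: "x \<in> V" using ball_subset_V x by auto
  have w: "w = (\<lambda>x. f (log_depth x))" by (rule ext) (rule w_def)
  have r: "\<bar>x \<bullet> b\<bar> \<le> r" if "b \<in> Basis" for b
    using inner_Basis_le[OF x(1) that] by (simp add: r_def t_def)
  have r0: "r \<ge> 0" and E0: "E \<ge> 0" by (simp_all add: r_def E_def)
  have rE: "r * E = exp t" "r * r * E\<^sup>2 = exp (2 * t)" "r * E\<^sup>2 = exp (3 * t)" "r * r * r * E ^ 3 = exp (3 * t)"
    by (simp_all add: r_def E_def exp_add[symmetric] exp_of_nat_mult[symmetric])
  have G1: "\<bar>G1 t\<bar> \<le> E * B"
    using bound(1)[OF t] by (simp add: G1_def abs_mult E_def)
  have "\<bar>2 * f1 t + f2 t\<bar> \<le> 3 * B" using bound(1,2)[OF t] by linarith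
  then have G2: "\<bar>G2 t\<bar> \<le> E\<^sup>2 * (3 * B)" by (simp add: G2_def abs_mult E_def)
  have "\<bar>8 * f1 t + 6 * f2 t + f3 t\<bar> \<le> 15 * B" using bound[OF t] by linarith
  then have G3: "\<bar>G3 t\<bar> \<le> E ^ 3 * (15 * B)" by (simp add: G3_def abs_mult E_def)
  note B0 = B_nonneg
  consider "cs = []" | b where "cs = [b]" | b c where "cs = [c, b]" | b c d where "cs = [d, c, b]"
  proof -
    have "length cs = 0 \<or> length cs = 1 \<or> length cs = 2 \<or> length cs = 3" using cs(2) by linarith
    then show ?thesis using that by (auto simp: length_Suc_conv numeral_2_eq_2 numeral_3_eq_3)
  qed
  then show ?thesis
  proof cases
    case 1
    have "\<bar>w x\<bar> \<le> B * exp t" using growth[OF t] by (simp add: w_def t_def)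
    also have "\<dots> \<le> 24 * B * exp t" using B0 by simp
    finally show ?thesis using 1 by (simp add: t_def)
  next
    case 2
    have "\<bar>(x \<bullet> b) * G1 t\<bar> \<le> r * (E * B)"
      unfolding abs_mult using r[of b] G1 cs 2 r0 by (intro mult_mono) auto
    also have "\<dots> = B * exp t" by (simp add: rE(1)[symmetric])
    also have "\<dots> \<le> 24 * B * exp t" using B0 by simp
    finally show ?thesis
      using 2 partial_deriv_radial[OF radial_derivs(1) xV, of b] by (simp add: t_def w)
  next
    case 3
    have "\<bar>(b \<bullet> c) * G1 t\<bar> \<le> 1 * (E * B)"
      unfolding abs_mult using abs_inner_Basis_le_1[of b c] G1 cs 3 by (intro mult_mono) auto
    moreover have "\<bar>(x \<bullet> b) * (x \<bullet> c) * G2 t\<bar> \<le> r * r * (E\<^sup>2 * (3 * B))"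
      unfolding abs_mult using r[of b] r[of c] G2 cs 3 r0 by (intro mult_mono) auto
    moreover have "r * r * (E\<^sup>2 * (3 * B)) = 3 * (B * exp (2 * t))" by (simp add: rE(2)[symmetric])
    moreover have "1 * (E * B) = B * exp (2 * t)" by (simp add: E_def)
    ultimately have "\<bar>(b \<bullet> c) * G1 t + (x \<bullet> b) * (x \<bullet> c) * G2 t\<bar> \<le> 4 * (B * exp (2 * t))"
      by linarith
    also have "\<dots> \<le> 24 * (B * exp (2 * t))" using B0 by (intro mult_right_mono) auto
    finally show ?thesis
      using 3 partial_deriv2_radial[OF radial_derivs(1,2) xV, of c b] by (simp add: t_def w)
  next
    case 4
    have bcd: "b \<in> Basis" "c \<in> Basis" "d \<in> Basis" using cs 4 by auto
    have mixed: "\<bar>(p \<bullet> q) * (x \<bullet> s)\<bar> \<le> r" if "p \<in> Basis" "q \<in> Basis" "s \<in> Basis" for p q s :: "real^4"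
      unfolding abs_mult using mult_mono[OF abs_inner_Basis_le_1[OF that(1,2)] r[OF that(3)]] by simp
    have "\<bar>(b \<bullet> c) * (x \<bullet> d) + (d \<bullet> b) * (x \<bullet> c) + (x \<bullet> b) * (d \<bullet> c)\<bar> \<le> 3 * r"
      using mixed[OF bcd] mixed[OF bcd(3,1,2)] mixed[OF bcd(3,2,1)]
      by (simp add: mult.commute[of "x \<bullet> b"] abs_le_iff)
    then have "\<bar>((b \<bullet> c) * (x \<bullet> d) + (d \<bullet> b) * (x \<bullet> c) + (x \<bullet> b) * (d \<bullet> c)) * G2 t\<bar> \<le> 3 * r * (E\<^sup>2 * (3 * B))"
      unfolding abs_mult[of _ "G2 t"] using G2 r0 by (intro mult_mono) auto
    moreover have "3 * r * (E\<^sup>2 * (3 * B)) = 9 * (B * exp (3 * t))" by (simp add: rE(3)[symmetric])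
    moreover have "\<bar>(x \<bullet> b) * (x \<bullet> c) * (x \<bullet> d) * G3 t\<bar> \<le> r * r * r * (E ^ 3 * (15 * B))"
      unfolding abs_mult using r[OF bcd(1)] r[OF bcd(2)] r[OF bcd(3)] G3 r0
      by (intro mult_mono) auto
    moreover have "r * r * r * (E ^ 3 * (15 * B)) = 15 * (B * exp (3 * t))"
      by (simp add: rE(4)[symmetric])
    ultimately have "\<bar>((b \<bullet> c) * (x \<bullet> d) + (d \<bullet> b) * (x \<bullet> c) + (x \<bullet> b) * (d \<bullet> c)) * G2 t
        + (x \<bullet> b) * (x \<bullet> c) * (x \<bullet> d) * G3 t\<bar> \<le> 24 * (B * exp (3 * t))"
      by linarith
    then show ?thesis
      using 4 partial_deriv3_radial[OF radial_derivs(1-3) xV, of d c b] by (simp add: t_def w)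
  qed
qed

lemma partial_derivs_w_measurable:
  assumes "set cs \<subseteq> Basis"
  shows "partial_derivs cs w \<in> borel_measurable (lebesgue_on (ball 0 1))"
  by (rule borel_measurable_lebesgue_on_punctured[OF open_ball smooth_on_continuous])
    (rule smooth_on_partial_derivs[OF smooth_w_ball assms])

lemma partial_derivs_w_cube_bound:
  assumes cs: "set cs \<subseteq> Basis" "length cs \<le> 3" and x: "x \<noteq> 0" "norm x < 1"
  shows "\<bar>partial_derivs cs w x\<bar> \<le> 24 * B * exp (3 * log_depth x)"
proof -
  have "exp (real (max 1 (length cs)) * log_depth x) \<le> exp (3 * log_depth x)"
    using cs(2) log_depth_pos[OF x] by (simp add: max_def)
  then have "24 * B * exp (real (max 1 (length cs)) * log_depth x) \<le> 24 * B * exp (3 * log_depth x)"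
    using B_nonneg by (intro mult_left_mono) auto
  then show ?thesis using partial_derivs_w_bound[OF assms] by linarith
qed

lemma partial_derivs_w_integrable:
  assumes cs: "set cs \<subseteq> Basis" "length cs \<le> 3"
  shows "integrable (lebesgue_on (ball 0 1)) (partial_derivs cs w)"
  by (rule integrable_on_unit_ball_powr_bound[OF partial_derivs_w_measurable[OF cs(1)]
        partial_derivs_w_cube_bound[OF cs]]) auto

lemma tendsto_mult_norm_cube:
  fixes g :: "real^4 \<Rightarrow> real"
  assumes "\<And>x. x \<noteq> 0 \<Longrightarrow> norm x < 1 \<Longrightarrow> \<bar>g x\<bar> \<le> C * exp (2 * log_depth x)"
  shows "((\<lambda>x. g x * norm x ^ 3) \<longlongrightarrow> 0) (at 0)"
proof (rule Lim_null_comparison)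
  show "\<forall>\<^sub>F x in at 0. norm (g x * norm x ^ 3) \<le> C * norm x"
    unfolding eventually_at
  proof (intro exI[of _ 1] conjI ballI impI, simp, elim conjE)
    fix x :: "real^4" assume x: "x \<noteq> 0" "dist x 0 < 1"
    have "norm (g x * norm x ^ 3) \<le> (C * exp (2 * log_depth x)) * norm x ^ 3"
      using assms[of x] x by (simp add: abs_mult mult_right_mono)
    also have "exp (2 * log_depth x) = (1 / norm x)\<^sup>2"
      by (simp add: exp_double exp_log_depth[OF x(1)])
    also have "C * (1 / norm x)\<^sup>2 * norm x ^ 3 = C * norm x"
      using x by (simp add: power2_eq_square power3_eq_cube)
    finally show "norm (g x * norm x ^ 3) \<le> C * norm x" .
  qed
  show "((\<lambda>x::real^4. C * norm x) \<longlongrightarrow> 0) (at 0)" by (auto intro!: tendsto_eq_intros)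
qed

lemma partial_derivs_w_tendsto:
  assumes cs: "set cs \<subseteq> Basis" "length cs < 3"
  shows "((\<lambda>x. partial_derivs cs w x * norm x ^ 3) \<longlongrightarrow> 0) (at 0)"
proof (rule tendsto_mult_norm_cube)
  fix x :: "real^4" assume x: "x \<noteq> 0" "norm x < 1"
  have "exp (real (max 1 (length cs)) * log_depth x) \<le> exp (2 * log_depth x)"
    using cs(2) log_depth_pos[OF x] by (simp add: max_def)
  then have "24 * B * exp (real (max 1 (length cs)) * log_depth x) \<le> 24 * B * exp (2 * log_depth x)"
    using B_nonneg by (intro mult_left_mono) auto
  then show "\<bar>partial_derivs cs w x\<bar> \<le> 24 * B * exp (2 * log_depth x)"
    using partial_derivs_w_bound[of cs x] cs x by simp
qed

lemma w_in_Sobolev: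
  assumes p: "1 < p" "p < 4 / 3"
  shows "in_Sobolev 3 p (ball 0 1) w"
  unfolding in_Sobolev_def
proof (intro conjI allI impI, goal_cases)
  case 1
  then show ?case
    using in_Lp_unit_ball_cube_bound[OF partial_derivs_w_measurable[of "[]"]
        partial_derivs_w_cube_bound[of "[]"], of p] p by simp
next
  case (2 bs)
  \<comment> \<open>Integration by parts reverses the order of differentiation, so the weak
    derivative along \<open>bs\<close> is the classical one along \<open>rev bs\<close>.\<close>
  have rev: "set (rev bs) \<subseteq> Basis" "length (rev bs) \<le> 3" using 2 by auto
  have "in_Lp p (ball 0 1) (partial_derivs (rev bs) w)"
    by (rule in_Lp_unit_ball_cube_bound[OF partial_derivs_w_measurable[OF rev(1)]
          partial_derivs_w_cube_bound[OF rev]]) (use p in auto)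
  moreover have "has_weak_partial_derivs w bs (partial_derivs (rev bs) w) (ball 0 1)"
    unfolding has_weak_partial_derivs_def
  proof (intro conjI allI impI)
    show "locally_integrable (ball 0 1) w"
      using locally_integrableI[OF partial_derivs_w_integrable[of "[]"] open_ball] by simp
    show "locally_integrable (ball 0 1) (partial_derivs (rev bs) w)"
      by (rule locally_integrableI[OF partial_derivs_w_integrable[OF rev] open_ball])
    fix \<phi> :: "real^4 \<Rightarrow> real" assume \<phi>: "test_function (ball 0 1) \<phi>"
    show "(LINT x|lebesgue_on (ball 0 1). w x * partial_derivs bs \<phi> x) =
        (-1) ^ length bs * (LINT x|lebesgue_on (ball 0 1). partial_derivs (rev bs) w x * \<phi> x)"
      using weak_partial_derivs_removable[OF open_ball smooth_w_ball, of 3 \<phi> bs "[]"]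
        partial_derivs_w_integrable partial_derivs_w_tendsto \<phi> 2 by simp
  qed
  ultimately show ?case by blast
qed

lemma H_nonneg: "t \<ge> 0 \<Longrightarrow> H t \<ge> 0"
  using H(1)[of t] by linarith

lemma bilaplacian_w_integrable: "integrable (lebesgue_on (ball 0 1)) (bilaplacian w)"
proof (rule integrable_on_unit_ball_shells[OF _ _ H(2) H_nonneg H(3)])
  have o: "open (ball 0 1 - {0::real^4})" by (rule open_delete[OF open_ball])
  show "bilaplacian w \<in> borel_measurable (lebesgue_on (ball 0 1))"
    unfolding bilaplacian_def
    by (intro borel_measurable_lebesgue_on_punctured[OF open_ball, of _ _ 0] smooth_on_continuous
        smooth_on_laplacian o smooth_w_ball)
  fix x :: "real^4" assume x: "x \<noteq> 0" "norm x < 1"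
  then have xV: "x \<in> V" using ball_subset_V by auto
  show "\<bar>bilaplacian w x\<bar> \<le> exp (real DIM(real^4) * log_depth x) * H (log_depth x)"
    using H(1)[of "log_depth x"] log_depth_pos[OF x]
    by (simp add: bilaplacian_w[OF xV] abs_mult)
qed

lemma w_distributional_bilaplacian:
  "has_distributional_bilaplacian w (bilaplacian w) (ball 0 1)"
  unfolding has_distributional_bilaplacian_def
proof (intro conjI allI impI)
  let ?U = "ball (0::real^4) 1"
  have o: "open (?U - {0})" by (rule open_delete[OF open_ball])
  show "locally_integrable ?U w"
    using locally_integrableI[OF partial_derivs_w_integrable[of "[]"] open_ball] by simp
  show "locally_integrable ?U (bilaplacian w)"
    by (rule locally_integrableI[OF bilaplacian_w_integrable open_ball])
  fix \<phi> :: "real^4 \<Rightarrow> real" assume \<phi>: "test_function ?U \<phi>"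
  have V: "x \<in> V" if "x \<noteq> 0" "norm x < 1" for x using ball_subset_V that by auto
  have lap: "\<bar>laplacian w x\<bar> \<le> 3 * B * exp (2 * log_depth x)" if x: "x \<noteq> 0" "norm x < 1" for x
  proof -
    have "\<bar>f2 (log_depth x) - 2 * f1 (log_depth x)\<bar> \<le> 3 * B"
      using bound(1,2)[of "log_depth x"] log_depth_pos[OF x] by linarith
    then have "exp (2 * log_depth x) * \<bar>f2 (log_depth x) - 2 * f1 (log_depth x)\<bar> \<le> exp (2 * log_depth x) * (3 * B)"
      by (intro mult_left_mono) auto
    then show ?thesis by (simp add: laplacian_w[OF V[OF x]] h0_def abs_mult mult_ac)
  qed
  \<comment> \<open>The factor \<open>4 * f1 - f3\<close> is kept instead of being bounded:
    \<open>|x|^(-3)\<close> alone is the critical size, and the vanishing flux comes from this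
    factor tending to 0. For integrability its bound \<open>5 * B\<close> suffices.\<close>
  have plap: "\<bar>partial_deriv b (laplacian w) x\<bar> \<le> \<bar>4 * f1 (log_depth x) - f3 (log_depth x)\<bar> * exp (3 * log_depth x)"
    if x: "x \<noteq> 0" "norm x < 1" and b: "b \<in> Basis" for x b
  proof -
    have e: "exp (- t) * (exp (2 * t) ^ 2) = exp (3 * t)" for t :: real
      by (simp add: exp_of_nat_mult[symmetric] exp_add[symmetric])
    have "\<bar>partial_deriv b (laplacian w) x\<bar> = \<bar>x \<bullet> b\<bar> * \<bar>h1 (log_depth x)\<bar>"
      by (simp add: partial_deriv_laplacian_w[OF V[OF x]] abs_mult)
    also have "\<dots> \<le> exp (- log_depth x) * \<bar>h1 (log_depth x)\<bar>"
      using inner_Basis_le[OF x(1) b] by (intro mult_right_mono) auto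
    also have "\<dots> = (exp (- log_depth x) * exp (2 * log_depth x) ^ 2) * \<bar>4 * f1 (log_depth x) - f3 (log_depth x)\<bar>"
      by (simp add: h1_def abs_mult)
    finally show ?thesis unfolding e by (simp only: mult.commute)
  qed
  show "(LINT x|lebesgue_on ?U. w x * bilaplacian \<phi> x) = (LINT x|lebesgue_on ?U. bilaplacian w x * \<phi> x)"
  proof (rule weak_bilaplacian_removable[OF open_ball smooth_w_ball _ _ _ _ _ bilaplacian_w_integrable \<phi>])
    show "integrable (lebesgue_on ?U) (partial_derivs cs w)" if "set cs \<subseteq> Basis" "length cs \<le> 2" for cs
      using partial_derivs_w_integrable that by simp
    show "((\<lambda>x. partial_derivs cs w x * norm x ^ (DIM(real^4) - 1)) \<longlongrightarrow> 0) (at 0)"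
      if "set cs \<subseteq> Basis" "length cs < 2" for cs
      using partial_derivs_w_tendsto[of cs] that by simp
    show "((\<lambda>x. laplacian w x * norm x ^ (DIM(real^4) - 1)) \<longlongrightarrow> 0) (at 0)"
      using tendsto_mult_norm_cube[OF lap] by simp
    fix b :: "real^4" assume b: "b \<in> Basis"
    show "integrable (lebesgue_on ?U) (partial_deriv b (laplacian w))"
    proof (rule integrable_on_unit_ball_powr_bound)
      show "partial_deriv b (laplacian w) \<in> borel_measurable (lebesgue_on ?U)"
        by (intro borel_measurable_lebesgue_on_punctured[OF open_ball, of _ _ 0] smooth_on_continuous
            smooth_on_partial_deriv smooth_on_laplacian o smooth_w_ball b)
      fix x :: "real^4" assume x: "x \<noteq> 0" "norm x < 1"
      have "\<bar>4 * f1 (log_depth x) - f3 (log_depth x)\<bar> \<le> 5 * B"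
        using bound(1,3)[of "log_depth x"] log_depth_pos[OF x] by linarith
      then have "\<bar>4 * f1 (log_depth x) - f3 (log_depth x)\<bar> * exp (3 * log_depth x) \<le> 5 * B * exp (3 * log_depth x)"
        by (intro mult_right_mono) auto
      then show "\<bar>partial_deriv b (laplacian w) x\<bar> \<le> 5 * B * exp (3 * log_depth x)"
        using plap[OF x b] by linarith
    qed simp
    have "((\<lambda>t. \<bar>4 * f1 t - f3 t\<bar>) \<longlongrightarrow> \<bar>4 * 0 - 0\<bar>) at_top"
      by (intro tendsto_intros tends)
    from filterlim_compose[OF this filterlim_log_depth[where 'a = "real^4"]]
    have lim: "((\<lambda>x::real^4. \<bar>4 * f1 (log_depth x) - f3 (log_depth x)\<bar>) \<longlongrightarrow> 0) (at 0)" by simp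
    have "((\<lambda>x. partial_deriv b (laplacian w) x * norm x ^ 3) \<longlongrightarrow> 0) (at 0)"
    proof (rule Lim_null_comparison[OF _ lim])
      show "\<forall>\<^sub>F x in at 0. norm (partial_deriv b (laplacian w) x * norm x ^ 3)
          \<le> \<bar>4 * f1 (log_depth x) - f3 (log_depth x)\<bar>"
        unfolding eventually_at
      proof (intro exI[of _ 1] conjI ballI impI, simp, elim conjE)
        fix x :: "real^4" assume x: "x \<noteq> 0" "dist x 0 < 1"
        have "norm (partial_deriv b (laplacian w) x * norm x ^ 3)
            \<le> (\<bar>4 * f1 (log_depth x) - f3 (log_depth x)\<bar> * exp (3 * log_depth x)) * norm x ^ 3"
          using plap[OF _ _ b, of x] x by (simp add: abs_mult mult_right_mono)
        also have "exp (3 * log_depth x) = (1 / norm x) ^ 3"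
          by (simp add: exp_log_depth[OF x(1), symmetric] exp_of_nat_mult[symmetric])
        also have "\<bar>4 * f1 (log_depth x) - f3 (log_depth x)\<bar> * (1 / norm x) ^ 3 * norm x ^ 3
            = \<bar>4 * f1 (log_depth x) - f3 (log_depth x)\<bar>"
          using x by (simp add: power_divide)
        finally show "norm (partial_deriv b (laplacian w) x * norm x ^ 3)
            \<le> \<bar>4 * f1 (log_depth x) - f3 (log_depth x)\<bar>" .
      qed
    qed
    then show "((\<lambda>x. partial_deriv b (laplacian w) x * norm x ^ (DIM(real^4) - 1)) \<longlongrightarrow> 0) (at 0)"
      by simp
  qed
qed

text \<open>The gradient of \<open>w\<close> is a multiple of \<open>f1\<close>, so
  \<open>f1 0 = 0\<close> makes it vanish on the unit sphere, in every direction.\<close>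

lemma w_normal_derivative:
  assumes "f1 0 = 0" and x: "x \<in> sphere 0 1"
  shows "has_normal_derivative w 0 S n x"
proof -
  have t: "log_depth x = 0" using x by (simp add: log_depth_def)
  have "x \<in> V" using x t by (auto simp: depth_domain_def)
  from has_derivative_radial[OF radial_derivs(1) this]
  have "(w has_derivative (\<lambda>h. 0)) (at x)"
    using assms(1) by (simp add: w_def[abs_def] t G1_def)
  then show ?thesis
    unfolding has_normal_derivative_def by (intro exI[of _ "\<lambda>h. 0"]) (simp add: has_derivative_at_withinI)
qed

end

section \<open>The singular profile\<close>

text \<open>The unperturbed profile is
  \<open>g y = 4\<^bsup>\<gamma>\<^esup> (y\<^bsup>\<gamma>\<^esup> - \<gamma> (2 - \<gamma>) / 4 \<cdot> y\<^bsup>\<gamma> - 1\<^esup> ln y)\<close>, the first two terms of the expansion of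
  \<open>(4 y - (2 - \<gamma>) ln y)\<^bsup>\<gamma>\<^esup>\<close>; \<open>g n\<close> is its \<open>n\<close>-th derivative.\<close>

locale log_profile =
  fixes \<gamma> :: real
  assumes \<gamma>: "1 / 2 < \<gamma>" "\<gamma> < 1"
begin

primrec a :: "nat \<Rightarrow> real" where
  "a 0 = 4 powr \<gamma>"
| "a (Suc n) = (\<gamma> - real n) * a n"

primrec q :: "nat \<Rightarrow> real" where
  "q 0 = - (4 powr \<gamma> * (\<gamma> * (2 - \<gamma>) / 4))"
| "q (Suc n) = (\<gamma> - 1 - real n) * q n"

text \<open>Differentiating \<open>y^s (p + q ln y)\<close> gives
  \<open>y^(s - 1) ((s p + q) + s q ln y)\<close>: the logarithm feeds \<open>q\<close> into the
  constant term at each step.\<close>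

primrec p :: "nat \<Rightarrow> real" where
  "p 0 = 0"
| "p (Suc n) = (\<gamma> - 1 - real n) * p n + q n"

definition g :: "nat \<Rightarrow> real \<Rightarrow> real" where
  "g n y = a n * y powr (\<gamma> - real n) + y powr (\<gamma> - 1 - real n) * (p n + q n * ln y)"

lemma g_deriv:
  assumes "y > 0"
  shows "(g n has_real_derivative g (Suc n) y) (at y)"
proof -
  have P: "((\<lambda>y. y powr s) has_real_derivative s * y powr (s - 1)) (at y)" for s
    using has_real_derivative_powr[OF assms] .
  have L: "((\<lambda>y. p n + q n * ln y) has_real_derivative q n / y) (at y)"
    using assms by (auto intro!: derivative_eq_intros)
  have "(g n has_real_derivative a n * ((\<gamma> - real n) * y powr (\<gamma> - real n - 1)) +
     ((\<gamma> - 1 - real n) * y powr (\<gamma> - 1 - real n - 1) * (p n + q n * ln y)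
       + q n / y * y powr (\<gamma> - 1 - real n))) (at y)"
    unfolding g_def[abs_def] by (intro DERIV_add DERIV_cmult DERIV_mult P L)
  also have "q n / y * y powr (\<gamma> - 1 - real n) = q n * y powr (\<gamma> - 1 - real n - 1)"
    using assms by (simp add: powr_diff power2_eq_square)
  also have "a n * ((\<gamma> - real n) * y powr (\<gamma> - real n - 1)) +
     ((\<gamma> - 1 - real n) * y powr (\<gamma> - 1 - real n - 1) * (p n + q n * ln y)
       + q n * y powr (\<gamma> - 1 - real n - 1)) = g (Suc n) y"
  proof -
    have "\<gamma> - real n - 1 = \<gamma> - real (Suc n)" "\<gamma> - 1 - real n - 1 = \<gamma> - 1 - real (Suc n)" by simp_all
    then show ?thesis unfolding g_def a.simps p.simps q.simps by (simp only:) (simp add: algebra_simps)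
  qed
  finally show ?thesis .
qed

lemma a_signs: "a 0 > 0" "a 1 > 0" "a 2 < 0"
  using \<gamma> by (auto simp: numeral_2_eq_2 mult_less_0_iff zero_less_mult_iff)

lemma g_tendsto_0:
  assumes "n \<ge> 1"
  shows "(g n \<longlongrightarrow> 0) at_top"
proof -
  have s: "\<gamma> - real n < 0" using assms \<gamma> by simp
  have "((\<lambda>y. A * y powr s + y powr (s - 1) * (P + Q * ln y)) \<longlongrightarrow> 0) at_top" if "s < 0" for A P Q s :: real
    using that by real_asymp
  from this[OF s, of "a n" "p n" "q n"] show ?thesis
    by (simp add: g_def[abs_def] algebra_simps)
qed

lemma g_asymptotics:
  "eventually (\<lambda>y. g 0 y > 0) at_top" "eventually (\<lambda>y. g 0 y \<le> y) at_top" "filterlim (g 0) at_top at_top"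
  "eventually (\<lambda>y. g 1 y > 0) at_top" "eventually (\<lambda>y. 2 * g 1 y + g 2 y > 0) at_top"
  "eventually (\<lambda>y. g 4 y - 4 * g 2 y > 0) at_top"
  "((\<lambda>y. (g 4 y - 4 * g 2 y) * y powr (2 - \<gamma>)) \<longlongrightarrow> - 4 * a 2) at_top"
proof -
  \<comment> \<open>The functions are spelled out with abstract coefficients: the signs of
    \<open>a 0\<close>, \<open>a 1\<close>, \<open>a 2\<close> decide, since \<open>p n\<close> and
    \<open>q n\<close> enter only terms of lower order.\<close>
  note \<gamma>
  moreover note a_signs
  ultimately have
    "eventually (\<lambda>y. a 0 * y powr (\<gamma> - 0) + y powr (\<gamma> - 1 - 0) * (p 0 + q 0 * ln y) > 0) at_top"
    "eventually (\<lambda>y. a 0 * y powr (\<gamma> - 0) + y powr (\<gamma> - 1 - 0) * (p 0 + q 0 * ln y) \<le> y) at_top"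
    "filterlim (\<lambda>y. a 0 * y powr (\<gamma> - 0) + y powr (\<gamma> - 1 - 0) * (p 0 + q 0 * ln y)) at_top at_top"
    "eventually (\<lambda>y. a 1 * y powr (\<gamma> - 1) + y powr (\<gamma> - 1 - 1) * (p 1 + q 1 * ln y) > 0) at_top"
    "eventually (\<lambda>y. 2 * (a 1 * y powr (\<gamma> - 1) + y powr (\<gamma> - 1 - 1) * (p 1 + q 1 * ln y))
        + (a 2 * y powr (\<gamma> - 2) + y powr (\<gamma> - 1 - 2) * (p 2 + q 2 * ln y)) > 0) at_top"
    "eventually (\<lambda>y. (a 4 * y powr (\<gamma> - 4) + y powr (\<gamma> - 1 - 4) * (p 4 + q 4 * ln y))
        - 4 * (a 2 * y powr (\<gamma> - 2) + y powr (\<gamma> - 1 - 2) * (p 2 + q 2 * ln y)) > 0) at_top"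
    "((\<lambda>y. ((a 4 * y powr (\<gamma> - 4) + y powr (\<gamma> - 1 - 4) * (p 4 + q 4 * ln y))
        - 4 * (a 2 * y powr (\<gamma> - 2) + y powr (\<gamma> - 1 - 2) * (p 2 + q 2 * ln y))) * y powr (2 - \<gamma>))
        \<longlongrightarrow> - 4 * a 2) at_top"
    by (real_asymp, real_asymp, real_asymp, real_asymp, real_asymp, real_asymp, real_asymp)
  then show
    "eventually (\<lambda>y. g 0 y > 0) at_top" "eventually (\<lambda>y. g 0 y \<le> y) at_top" "filterlim (g 0) at_top at_top"
    "eventually (\<lambda>y. g 1 y > 0) at_top" "eventually (\<lambda>y. 2 * g 1 y + g 2 y > 0) at_top"
    "eventually (\<lambda>y. g 4 y - 4 * g 2 y > 0) at_top"
    "((\<lambda>y. (g 4 y - 4 * g 2 y) * y powr (2 - \<gamma>)) \<longlongrightarrow> - 4 * a 2) at_top"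
    by (simp_all only: g_def[abs_def] of_nat_0 of_nat_1 of_nat_numeral)
qed

text \<open>The asymptotic signs and bounds hold only for large \<open>y\<close>. Replacing
  \<open>t\<close> by \<open>t + k\<close> amounts to the dilation of \<open>x\<close> by
  \<open>exp (- k)\<close>, which makes them available on the whole unit ball. With
  \<open>k \<ge> 2\<close> the argument \<open>t + k\<close> stays above 1 on \<open>t > -1\<close>,
  away from the singularity of \<open>g n\<close> at 0.\<close>

lemma exists_shift:
  obtains k where "k \<ge> 2"
    "\<And>y. y \<ge> k \<Longrightarrow> 0 < g 0 y \<and> g 0 y \<le> y \<and> 0 < g 1 y \<and> 0 < 2 * g 1 y + g 2 y"
    "\<And>y. y \<ge> k \<Longrightarrow> 0 < g 4 y - 4 * g 2 y \<and> g 4 y - 4 * g 2 y \<le> (1 - 4 * a 2) * y powr (\<gamma> - 2)"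
    "\<And>y. y \<ge> k \<Longrightarrow> \<bar>g 1 y\<bar> \<le> 1 \<and> \<bar>g 2 y\<bar> \<le> 1 \<and> \<bar>g 3 y\<bar> \<le> 1"
proof -
  have small: "eventually (\<lambda>y. \<bar>g n y\<bar> \<le> 1) at_top" if "n \<ge> 1" for n
    using tendstoD[OF g_tendsto_0[OF that], of 1] by (auto elim: eventually_mono)
  have "eventually (\<lambda>y. (g 4 y - 4 * g 2 y) * y powr (2 - \<gamma>) < 1 - 4 * a 2) at_top"
    by (rule order_tendstoD(2)[OF g_asymptotics(7)]) simp
  with eventually_gt_at_top[of 0]
  have "eventually (\<lambda>y. g 4 y - 4 * g 2 y \<le> (1 - 4 * a 2) * y powr (\<gamma> - 2)) at_top"
  proof eventually_elim
    case (elim y)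
    then have "(g 4 y - 4 * g 2 y) * y powr (2 - \<gamma>) * y powr (\<gamma> - 2) \<le> (1 - 4 * a 2) * y powr (\<gamma> - 2)"
      by (intro mult_right_mono) auto
    moreover have "y powr (2 - \<gamma>) * y powr (\<gamma> - 2) = 1"
      using elim by (simp add: powr_add[symmetric])
    ultimately show ?case by (simp add: mult.assoc)
  qed
  with small[of 1] small[of 2] small[of 3] g_asymptotics
  have "eventually (\<lambda>y. (0 < g 0 y \<and> g 0 y \<le> y \<and> 0 < g 1 y \<and> 0 < 2 * g 1 y + g 2 y) \<and>
      (0 < g 4 y - 4 * g 2 y \<and> g 4 y - 4 * g 2 y \<le> (1 - 4 * a 2) * y powr (\<gamma> - 2)) \<and>
      (\<bar>g 1 y\<bar> \<le> 1 \<and> \<bar>g 2 y\<bar> \<le> 1 \<and> \<bar>g 3 y\<bar> \<le> 1)) at_top"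
    by (simp add: eventually_conj_iff)
  then obtain k0 where k0: "\<And>y. y \<ge> k0 \<Longrightarrow>
      (0 < g 0 y \<and> g 0 y \<le> y \<and> 0 < g 1 y \<and> 0 < 2 * g 1 y + g 2 y) \<and>
      (0 < g 4 y - 4 * g 2 y \<and> g 4 y - 4 * g 2 y \<le> (1 - 4 * a 2) * y powr (\<gamma> - 2)) \<and>
      (\<bar>g 1 y\<bar> \<le> 1 \<and> \<bar>g 2 y\<bar> \<le> 1 \<and> \<bar>g 3 y\<bar> \<le> 1)"
    unfolding eventually_at_top_linorder by blast
  show ?thesis
    by (rule that[of "max 2 k0"]) (use k0 in \<open>simp_all\<close>)
qed

end

section \<open>The profile corrected to satisfy the Dirichlet conditions\<close>

locale shifted_log_profile = log_profile +
  fixes k :: real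
  assumes k2: "k \<ge> 2"
    and g_pos: "\<And>y. y \<ge> k \<Longrightarrow> 0 < g 0 y \<and> g 0 y \<le> y \<and> 0 < g 1 y \<and> 0 < 2 * g 1 y + g 2 y"
    and g_bilap: "\<And>y. y \<ge> k \<Longrightarrow>
      0 < g 4 y - 4 * g 2 y \<and> g 4 y - 4 * g 2 y \<le> (1 - 4 * a 2) * y powr (\<gamma> - 2)"
    and g_le_1: "\<And>y. y \<ge> k \<Longrightarrow> \<bar>g 1 y\<bar> \<le> 1 \<and> \<bar>g 2 y\<bar> \<le> 1 \<and> \<bar>g 3 y\<bar> \<le> 1"
begin

text \<open>In terms of \<open>r = e\<^bsup>-t\<^esup>\<close> the profile is \<open>g(t + k) - M r + C r\<^sup>2\<close>. The term \<open>C r\<^sup>2\<close> is biharmonic and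
  \<open>- M r\<close> contributes \<open>3 M r\<^bsup>-3\<^esup> > 0\<close> to the bilaplacian; \<open>M\<close> and \<open>C\<close> are fixed by the two boundary
  conditions at \<open>t = 0\<close>. Both terms decay exponentially in \<open>t\<close>, so that they do not affect
  the asymptotics of \<open>exp (w\<^bsup>1/\<gamma>\<^esup>)\<close>.\<close>

definition M :: real where "M = 2 * g 0 k + g 1 k"
definition C :: real where "C = g 0 k + g 1 k"

definition F :: "nat \<Rightarrow> real \<Rightarrow> real" where
  "F n t = g n (t + k) - (-1) ^ n * M * exp (- t) + (-2) ^ n * C * exp (- 2 * t)"

lemma M_pos: "M > 0" and C_pos: "C > 0"
  using g_pos[of k] by (simp_all add: M_def C_def)

lemma F_deriv:
  assumes "t > -1"
  shows "(F n has_real_derivative F (Suc n) t) (at t)"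
proof -
  have 1: "((\<lambda>t. g n (t + k)) has_real_derivative g (Suc n) (t + k)) (at t)"
    using g_deriv[of "t + k" n] assms k2 DERIV_shift[of "g n" _ t k] by simp
  have 2: "((\<lambda>t. (-1) ^ n * M * exp (- t)) has_real_derivative (-1) ^ n * M * - exp (- t)) (at t)"
    by (auto intro!: derivative_eq_intros)
  have 3: "((\<lambda>t. (-2) ^ n * C * exp (- 2 * t)) has_real_derivative (-2) ^ n * C * (- 2 * exp (- 2 * t))) (at t)"
    by (auto intro!: derivative_eq_intros)
  from DERIV_add[OF DERIV_diff[OF 1 2] 3] show ?thesis
    by (simp add: F_def[abs_def] algebra_simps)
qed

lemma F_smooth: "smooth_on {-1<..} (F n)"
  unfolding smooth_on_def
proof
  fix m show "Ck_on m {-1<..} (F n)"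
  proof (induction m arbitrary: n)
    case 0
    have "continuous (at t) (F n)" if "t > -1" for t
      using F_deriv[OF that] by (rule DERIV_isCont)
    then show ?case by (simp add: continuous_at_imp_continuous_on)
  next
    case (Suc m)
    show ?case by (rule Ck_on_Suc_realI[OF _ F_deriv Suc]) auto
  qed
qed

lemma F_0_0: "F 0 0 = 0" and F_1_0: "F 1 0 = 0"
  by (simp_all add: F_def M_def C_def)

lemma F_bilap: "F 4 t - 4 * F 2 t = g 4 (t + k) - 4 * g 2 (t + k) + 3 * M * exp (- t)"
  by (simp add: F_def algebra_simps)

lemma F_bilap_pos: "t \<ge> 0 \<Longrightarrow> F 4 t - 4 * F 2 t > 0"
  using g_bilap[of "t + k"] M_pos by (simp add: F_bilap add_pos_pos)

text \<open>With the integrating factor \<open>exp (2 * t)\<close>, the derivative of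
  \<open>exp (2 * t) * F 1 t\<close> is \<open>exp (2 * t) * (2 * F 1 t + F 2 t)\<close>. The
  \<open>C\<close> term drops out because \<open>exp (- 2 * t)\<close> solves
  \<open>2 f' + f'' = 0\<close>, the \<open>M\<close> term adds \<open>M * exp t\<close>, and the
  rest is positive by the choice of \<open>k\<close>. Since \<open>F 1 0 = 0\<close>, growth from
  zero gives positivity.\<close>

lemma F_1_pos:
  assumes "t > 0"
  shows "F 1 t > 0"
proof -
  define \<phi> where "\<phi> t = exp (2 * t) * F 1 t" for t
  have eF: "exp (2 * s) * (2 * F 1 s + F 2 s) = exp (2 * s) * (2 * g 1 (s + k) + g 2 (s + k)) + M * exp s" for s
  proof -
    have "exp (2 * s) * (2 * F 1 s + F 2 s) =
        exp (2 * s) * (2 * g 1 (s + k) + g 2 (s + k)) + M * (exp (2 * s) * exp (- s))"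
      by (simp add: F_def algebra_simps)
    also have "exp (2 * s) * exp (- s) = exp s" by (simp add: exp_add[symmetric])
    finally show ?thesis .
  qed
  have "\<phi> 0 < \<phi> t"
  proof (rule DERIV_pos_imp_increasing[OF assms])
    fix s assume s: "0 \<le> s" "s \<le> t"
    have "(F 1 has_real_derivative F 2 s) (at s)"
      using F_deriv[of s 1] s by (simp add: numeral_2_eq_2)
    then have "(\<phi> has_real_derivative exp (2 * s) * (2 * F 1 s + F 2 s)) (at s)"
      unfolding \<phi>_def[abs_def] by (auto intro!: derivative_eq_intros simp: algebra_simps)
    moreover have "exp (2 * s) * (2 * F 1 s + F 2 s) > 0"
      unfolding eF using g_pos[of "s + k"] s M_pos
      by (intro add_pos_pos[OF mult_pos_pos mult_pos_pos]) simp_all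
    ultimately show "\<exists>y. (\<phi> has_real_derivative y) (at s) \<and> 0 < y" by blast
  qed
  then show ?thesis by (simp add: \<phi>_def F_1_0[simplified] zero_less_mult_iff)
qed

lemma F_0_pos:
  assumes "t > 0"
  shows "F 0 t > 0"
proof -
  have "F 0 0 < F 0 t"
  proof (rule DERIV_pos_imp_increasing_open[OF assms])
    show "\<exists>y. (F 0 has_real_derivative y) (at s) \<and> 0 < y" if "0 < s" "s < t" for s
      using F_deriv[of s 0] F_1_pos[OF that(1)] that by auto
    show "continuous_on {0..t} (F 0)"
      by (rule continuous_on_subset[OF smooth_on_continuous[OF F_smooth]]) auto
  qed
  then show ?thesis by (simp add: F_0_0)
qed

text \<open>Decreasing, and summable because the exponent \<open>\<gamma> - 2\<close> is below -1;
  the second term is the contribution of \<open>- M r\<close>.\<close>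

definition H :: "real \<Rightarrow> real" where
  "H t = (1 - 4 * a 2) * (t + k) powr (\<gamma> - 2) + 3 * M * exp (- t)"

text \<open>\<open>1\<close> bounds \<open>g 1\<close>, \<open>g 2\<close>, \<open>g 3\<close>;
  \<open>k\<close> enters through \<open>g 0 (t + k) \<le> t + k\<close>; the factor 8 is
  \<open>2 ^ 3\<close>, from three derivatives of \<open>exp (- 2 * t)\<close>.\<close>

definition B :: real where "B = k + 1 + M + 8 * C"

lemma F_tendsto_0:
  assumes "n \<ge> 1"
  shows "(F n \<longlongrightarrow> 0) at_top"
proof -
  have "filterlim (\<lambda>t. t + k) at_top at_top" by real_asymp
  from filterlim_compose[OF g_tendsto_0[OF assms] this]
  have "((\<lambda>t. g n (t + k)) \<longlongrightarrow> 0) at_top" .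
  moreover have "((\<lambda>t. (-1) ^ n * M * exp (- t)) \<longlongrightarrow> 0) at_top" for M :: real
    by (rule tendsto_mult_right_zero) real_asymp
  moreover have "((\<lambda>t. (-2) ^ n * C * exp (- 2 * t)) \<longlongrightarrow> 0) at_top" for C :: real
    by (rule tendsto_mult_right_zero) real_asymp
  ultimately have "((\<lambda>t. g n (t + k) - (-1) ^ n * M * exp (- t) + (-2) ^ n * C * exp (- 2 * t)) \<longlongrightarrow> 0 - 0 + 0) at_top"
    by (intro tendsto_add tendsto_diff)
  then show ?thesis by (simp add: F_def[abs_def])
qed

lemma F_remainder_le:
  assumes "t \<ge> 0" "n \<le> 3"
  shows "\<bar>(-1) ^ n * M * exp (- t)\<bar> \<le> M" "\<bar>(-2) ^ n * C * exp (- 2 * t)\<bar> \<le> 8 * C"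
proof -
  have "M * exp (- t) \<le> M * 1" using assms M_pos by (intro mult_left_mono) auto
  then show "\<bar>(-1) ^ n * M * exp (- t)\<bar> \<le> M" using M_pos by (simp add: abs_mult power_abs)
  have "(2::real) ^ n \<le> 2 ^ 3" using assms by (intro power_increasing) auto
  then have "2 ^ n * C * exp (- 2 * t) \<le> 8 * C * 1" using assms C_pos by (intro mult_mono) auto
  then show "\<bar>(-2) ^ n * C * exp (- 2 * t)\<bar> \<le> 8 * C" using C_pos by (simp add: abs_mult power_abs)
qed

lemma F_le:
  assumes "t \<ge> 0" "n \<le> 3"
  shows "\<bar>F n t\<bar> \<le> \<bar>g n (t + k)\<bar> + M + 8 * C"
proof -
  have "\<bar>x - y + z\<bar> \<le> \<bar>x\<bar> + \<bar>y\<bar> + \<bar>z\<bar>" for x y z :: real by linarith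
  from order_trans[OF this add_mono[OF add_mono[OF order_refl F_remainder_le(1)[OF assms]]
        F_remainder_le(2)[OF assms]]]
  show ?thesis unfolding F_def .
qed

sublocale radial_profile "F 0" "F 1" "F 2" "F 3" "F 4" H B
proof
  fix t :: real
  show "(F 0 has_real_derivative F 1 t) (at t)" "(F 1 has_real_derivative F 2 t) (at t)"
    "(F 2 has_real_derivative F 3 t) (at t)" "(F 3 has_real_derivative F 4 t) (at t)" if "t > -1"
    using F_deriv[OF that, of 0] F_deriv[OF that, of 1] F_deriv[OF that, of 2] F_deriv[OF that, of 3]
    by (simp_all add: eval_nat_numeral)
  show "smooth_on {-1<..} (F 0)" by (rule F_smooth)
  show "(F 1 \<longlongrightarrow> 0) at_top" "(F 3 \<longlongrightarrow> 0) at_top" by (rule F_tendsto_0; simp)+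
  show "\<bar>F 1 t\<bar> \<le> B" "\<bar>F 2 t\<bar> \<le> B" "\<bar>F 3 t\<bar> \<le> B" if t: "t \<ge> 0"
    using F_le[OF t, of 1] F_le[OF t, of 2] F_le[OF t, of 3] g_le_1[of "t + k"] t k2
    by (simp_all add: B_def)
  show "\<bar>F 0 t\<bar> \<le> B * exp t" if t: "t \<ge> 0"
  proof -
    have e: "1 + t \<le> exp t" by (rule exp_ge_add_one_self)
    have "\<bar>F 0 t\<bar> \<le> t + k + M + 8 * C"
      using F_le[OF t, of 0] g_pos[of "t + k"] t by simp
    also have "\<dots> \<le> B * (1 + t)"
    proof -
      have "t * 1 \<le> t * B" using t k2 M_pos C_pos by (intro mult_left_mono) (auto simp: B_def)
      then show ?thesis by (simp add: B_def algebra_simps)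
    qed
    also have "\<dots> \<le> B * exp t" using e k2 M_pos C_pos by (intro mult_left_mono) (auto simp: B_def)
    finally show ?thesis .
  qed
  show "\<bar>F 4 t - 4 * F 2 t\<bar> \<le> H t" if t: "t \<ge> 0"
    using F_bilap_pos[OF t] g_bilap[of "t + k"] t by (simp add: H_def F_bilap)
  show "H t \<le> H s" if "0 \<le> s" "s \<le> t" for s
    unfolding H_def using that k2 \<gamma> a_signs M_pos
    by (intro add_mono mult_left_mono powr_mono2') auto
  show "summable (\<lambda>n. H (real n))"
    unfolding H_def
  proof (intro summable_add summable_mult)
    show "summable (\<lambda>n. (real n + k) powr (\<gamma> - 2))"
    proof (rule summable_comparison_test'[of "\<lambda>n. real n powr (\<gamma> - 2)" 1])
      show "summable (\<lambda>n. real n powr (\<gamma> - 2))" using \<gamma> by (simp add: summable_real_powr_iff)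
      show "norm ((real n + k) powr (\<gamma> - 2)) \<le> real n powr (\<gamma> - 2)" if "n \<ge> 1" for n
        using that k2 \<gamma> by (simp, intro powr_mono2') auto
    qed
    have "summable (\<lambda>n. exp (- 1 :: real) ^ n)" by (intro summable_geometric) simp
    then show "summable (\<lambda>n. exp (- real n))" by (simp add: exp_of_nat2_mult[symmetric])
  qed
qed

end

section \<open>The coefficient, the equation and unboundedness\<close>

context shifted_log_profile
begin

text \<open>The quotient of the bilaplacian of \<open>w\<close> by \<open>exp (w^\<alpha>)\<close>,
  as a function of \<open>t\<close>; it is the coefficient off the origin.\<close>

definition R :: "real \<Rightarrow> real" where
  "R t = (F 4 t - 4 * F 2 t) * exp (4 * t) * exp (- (F 0 t powr (1 / \<gamma>)))"

lemma R_pos: "t \<ge> 0 \<Longrightarrow> R t > 0"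
  using F_bilap_pos[of t] by (simp add: R_def)

text \<open>With \<open>y = t + k\<close>, \<open>F 0 t = (4 y)^\<gamma> E(y)\<close>, where
  \<open>E\<close> is 1 minus \<open>\<gamma> (2 - \<gamma>) / 4 * ln y / y\<close> up to
  exponentially small terms. Raising \<open>E\<close> to the power \<open>1/\<gamma>\<close> leaves
  an error \<open>O((ln y / y)^2)\<close>, which tends to 0 even after multiplication by
  \<open>4 y\<close>. This is why two terms in \<open>g\<close> are enough.\<close>

lemma F_0_powr_asymptotics:
  "((\<lambda>t. F 0 t powr (1 / \<gamma>) - 4 * (t + k) + (2 - \<gamma>) * ln (t + k)) \<longlongrightarrow> 0) at_top"
proof -
  \<comment> \<open>The corrections rewritten in \<open>y\<close>, using
    \<open>exp (- t) = exp k * exp (- y)\<close>, and divided by \<open>4 powr \<gamma>\<close>; the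
    factor \<open>y powr (- \<gamma>)\<close> appears in \<open>E\<close>.\<close>
  define M' where "M' = - (4 powr - \<gamma> * M * exp k)"
  define C' where "C' = 4 powr - \<gamma> * C * exp (2 * k)"
  define E where "E y = 1 - \<gamma> * (2 - \<gamma>) / 4 * ln y / y + M' * y powr (- \<gamma>) * exp (- y)
      + C' * y powr (- \<gamma>) * exp (- 2 * y)" for y
  have lim: "((\<lambda>y. 4 * y * (E y powr (1 / \<gamma>) - 1) + (2 - \<gamma>) * ln y) \<longlongrightarrow> 0) at_top"
    unfolding E_def using \<gamma> by real_asymp
  have shift: "filterlim (\<lambda>t. t + k) at_top at_top" by real_asymp
  have eq: "F 0 t powr (1 / \<gamma>) = 4 * (t + k) * E (t + k) powr (1 / \<gamma>)" if t: "t > 0" for t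
  proof -
    define y where "y = t + k"
    have y: "y > 0" using t k2 by (simp add: y_def)
    have s: "4 powr \<gamma> * 4 powr - \<gamma> = (1::real)" "y powr \<gamma> * y powr - \<gamma> = 1"
      using y by (simp_all add: powr_add[symmetric])
    have ly: "y powr (\<gamma> - 1) = y powr \<gamma> / y" using y by (simp add: powr_diff)
    have t': "exp (- t) = exp k * exp (- y)" "exp (- 2 * t) = exp (2 * k) * exp (- 2 * y)"
      by (simp_all add: y_def exp_add[symmetric])
    have "A * z + z / y * (0 + - (A * c) * l) = (A * z) * (1 - c * l / y)" for A z c l :: real
      by (simp add: algebra_simps)
    then have g0: "g 0 y = (4 powr \<gamma> * y powr \<gamma>) * (1 - \<gamma> * (2 - \<gamma>) / 4 * ln y / y)"
      by (simp only: g_def a.simps p.simps q.simps of_nat_0 diff_zero ly)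
    have "F 0 t = (4 powr \<gamma> * y powr \<gamma>) * (1 - \<gamma> * (2 - \<gamma>) / 4 * ln y / y)
        - M * (exp k * exp (- y)) + C * (exp (2 * k) * exp (- 2 * y))"
      unfolding F_def t' y_def[symmetric] g0 by simp
    also have "M * (exp k * exp (- y)) = (4 powr \<gamma> * 4 powr - \<gamma>) * (y powr \<gamma> * y powr - \<gamma>) * (M * (exp k * exp (- y)))"
      by (simp only: s mult_1)
    also have "C * (exp (2 * k) * exp (- 2 * y)) =
        (4 powr \<gamma> * 4 powr - \<gamma>) * (y powr \<gamma> * y powr - \<gamma>) * (C * (exp (2 * k) * exp (- 2 * y)))"
      by (simp only: s mult_1)
    finally have FE: "F 0 t = (4 powr \<gamma> * y powr \<gamma>) * E y"
      by (simp only: E_def M'_def C'_def) (simp add: algebra_simps)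
    have "4 powr \<gamma> * y powr \<gamma> > 0" using y by simp
    \<comment> \<open>Positivity of \<open>E y\<close> is inherited from
      \<open>F 0 t\<close>.\<close>
    then have "E y > 0"
      using F_0_pos[OF t] unfolding FE by (metis zero_less_mult_pos)
    then show ?thesis
      using y \<gamma> unfolding FE y_def[symmetric] by (simp add: powr_mult powr_powr)
  qed
  have "eventually (\<lambda>t. 4 * (t + k) * (E (t + k) powr (1 / \<gamma>) - 1) + (2 - \<gamma>) * ln (t + k)
      = F 0 t powr (1 / \<gamma>) - 4 * (t + k) + (2 - \<gamma>) * ln (t + k)) at_top"
    using eventually_gt_at_top[of 0] by eventually_elim (simp add: eq algebra_simps)
  from Lim_transform_eventually[OF filterlim_compose[OF lim shift] this] show ?thesis .
qed

text \<open>By the asymptotics of the exponent,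
  \<open>exp (4 * t - F 0 t powr (1 / \<gamma>))\<close> is
  \<open>(t + k) powr (2 - \<gamma>)\<close> times a factor tending to \<open>exp (- 4 * k)\<close>.
  That power exactly compensates the decay of \<open>F 4 - 4 * F 2\<close>; the \<open>- M r\<close>
  correction is exponentially smaller. The limit is positive because \<open>a 2 < 0\<close>.\<close>

lemma R_tendsto: "(R \<longlongrightarrow> - 4 * a 2 * exp (- 4 * k)) at_top"
proof -
  define P where "P t = F 0 t powr (1 / \<gamma>) - 4 * (t + k) + (2 - \<gamma>) * ln (t + k)" for t
  have shift: "filterlim (\<lambda>t. t + k) at_top at_top" by real_asymp
  have 1: "((\<lambda>t. (g 4 (t + k) - 4 * g 2 (t + k)) * (t + k) powr (2 - \<gamma>)) \<longlongrightarrow> - 4 * a 2) at_top"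
    by (rule filterlim_compose[OF g_asymptotics(7) shift])
  have "((\<lambda>t. exp (- t) * (t + k) powr (2 - \<gamma>)) \<longlongrightarrow> 0) at_top" by real_asymp
  from tendsto_add[OF 1 tendsto_mult[OF tendsto_const[of "3 * M"] this]]
  have 2: "((\<lambda>t. (F 4 t - 4 * F 2 t) * (t + k) powr (2 - \<gamma>)) \<longlongrightarrow> - 4 * a 2) at_top"
    by (simp add: F_bilap algebra_simps)
  have 3: "((\<lambda>t. exp (- P t)) \<longlongrightarrow> exp (- 0)) at_top"
    unfolding P_def by (intro tendsto_exp tendsto_minus F_0_powr_asymptotics)
  have lim: "((\<lambda>t. (F 4 t - 4 * F 2 t) * (t + k) powr (2 - \<gamma>) * exp (- P t) * exp (- 4 * k))
      \<longlongrightarrow> - 4 * a 2 * exp (- 0) * exp (- 4 * k)) at_top"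
    by (intro tendsto_mult 2 3 tendsto_const)
  have "eventually (\<lambda>t. (F 4 t - 4 * F 2 t) * (t + k) powr (2 - \<gamma>) * exp (- P t) * exp (- 4 * k) = R t) at_top"
    using eventually_gt_at_top[of 0]
  proof eventually_elim
    case (elim t)
    have "(t + k) powr (2 - \<gamma>) * exp (- P t) * exp (- 4 * k)
        = exp ((2 - \<gamma>) * ln (t + k) + - P t + - 4 * k)"
    proof -
      have "(t + k) powr (2 - \<gamma>) = exp ((2 - \<gamma>) * ln (t + k))"
        using elim k2 by (simp add: powr_def)
      then show ?thesis by (simp only: exp_add)
    qed
    also have "(2 - \<gamma>) * ln (t + k) + - P t + - 4 * k = 4 * t + - (F 0 t powr (1 / \<gamma>))"
      by (simp add: P_def)
    finally show ?case by (simp only: R_def exp_add mult.assoc)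
  qed
  from Lim_transform_eventually[OF lim this] show ?thesis by simp
qed

lemma R_continuous: "continuous_on {0..} R"
proof -
  have F: "continuous_on {0..} (F n)" for n
    by (rule continuous_on_subset[OF smooth_on_continuous[OF F_smooth]]) auto
  have nonneg: "F 0 t \<ge> 0" if "t \<ge> 0" for t
    using F_0_pos[of t] F_0_0 that by (cases "t = 0") auto
  have "continuous_on {0..} (\<lambda>t. F 0 t powr (1 / \<gamma>))"
    \<comment> \<open>At \<open>t = 0\<close> the base is 0, where the power is continuous because
      the exponent \<open>1 / \<gamma>\<close> is positive.\<close>
    by (rule continuous_on_powr'[OF F continuous_on_const]) (use nonneg \<gamma> in auto)
  then show ?thesis
    unfolding R_def[abs_def]
    by (intro continuous_on_mult continuous_on_diff continuous_on_exp continuous_on_minus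
        continuous_on_const continuous_on_id F)
qed

definition coeff :: "real^4 \<Rightarrow> real" where
  "coeff x = (if x = 0 then - 4 * a 2 * exp (- 4 * k) else R (log_depth x))"

lemma coeff_pos: "x \<in> cball 0 1 \<Longrightarrow> coeff x > 0"
  using a_signs(3) R_pos[OF log_depth_nonneg[of x]] by (simp add: coeff_def mult_neg_pos)

lemma coeff_continuous: "continuous_on (cball 0 1) coeff"
  unfolding continuous_on_eq_continuous_within
proof
  fix x :: "real^4" assume x: "x \<in> cball 0 1"
  show "continuous (at x within cball 0 1) coeff"
  proof (cases "x = 0")
    case True
    have "((\<lambda>x::real^4. R (log_depth x)) \<longlongrightarrow> coeff 0) (at 0)"
      using filterlim_compose[OF R_tendsto filterlim_log_depth] by (simp add: coeff_def)
    then have "(coeff \<longlongrightarrow> coeff 0) (at 0)"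
      by (rule Lim_transform_eventually) (auto simp: eventually_at_filter coeff_def)
    then show ?thesis using True
      by (simp add: continuous_within tendsto_within_subset[OF _ subset_UNIV])
  next
    case False
    have "continuous_on (cball 0 1 - {0}) (log_depth :: real^4 \<Rightarrow> real)"
      by (rule continuous_on_subset[OF smooth_on_continuous[OF smooth_on_log_depth]]) auto
    then have "continuous_on (cball 0 1 - {0}) (\<lambda>x::real^4. R (log_depth x))"
      by (rule continuous_on_compose2[OF R_continuous]) (auto intro: log_depth_nonneg)
    then have "continuous_on (cball 0 1 - {0}) coeff"
      by (rule continuous_on_eq) (simp add: coeff_def)
    then have "continuous (at x within cball 0 1 - {0}) coeff"
      using x False by (simp add: continuous_on_eq_continuous_within)
    moreover have "at x within cball 0 1 - {0} = at x within cball 0 1"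
      by (rule at_within_nhd[of x "- {0}"]) (use False in \<open>auto intro!: open_Compl\<close>)
    ultimately show ?thesis by simp
  qed
qed

lemma equation_off_origin:
  assumes "x \<in> ball 0 1" "x \<noteq> 0"
  shows "coeff x * exp (w x powr (1 / \<gamma>)) = bilaplacian w x"
proof -
  have "x \<in> V" using assms ball_subset_V by auto
  then show ?thesis
    using assms(2) by (simp add: bilaplacian_w coeff_def R_def w_def exp_minus)
qed

lemma equation_AE:
  "AE x in lebesgue_on (ball 0 1). coeff x * exp (w x powr (1 / \<gamma>)) = bilaplacian w x"
proof -
  have B: "ball (0::real^4) 1 \<in> sets lebesgue" by auto
  show ?thesis
    using AE_lebesgue_on_neq[OF B, of 0] AE_space
  proof eventually_elim
    case (elim x)
    then show ?case by (intro equation_off_origin) auto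
  qed
qed

lemma rhs_measurable:
  "(\<lambda>x. coeff x * exp (w x powr (1 / \<gamma>))) \<in> borel_measurable (lebesgue_on (ball 0 1))"
proof (rule borel_measurable_lebesgue_on_punctured[OF open_ball])
  have o: "open (ball 0 1 - {0::real^4})" by (rule open_delete[OF open_ball])
  have "continuous_on (ball 0 1 - {0}) (bilaplacian w)"
    unfolding bilaplacian_def by (intro smooth_on_continuous smooth_on_laplacian o smooth_w_ball)
  then show "continuous_on (ball 0 1 - {0}) (\<lambda>x. coeff x * exp (w x powr (1 / \<gamma>)))"
    by (rule continuous_on_eq) (simp add: equation_off_origin)
qed

lemma rhs_integrable:
  "integrable (lebesgue_on (ball 0 1)) (\<lambda>x. coeff x * exp (w x powr (1 / \<gamma>)))"
  using integrable_cong_AE[OF rhs_measurable borel_measurable_integrable[OF bilaplacian_w_integrable]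
      equation_AE] bilaplacian_w_integrable by simp

lemma distributional_solution:
  "has_distributional_bilaplacian w (\<lambda>x. coeff x * exp (w x powr (1 / \<gamma>))) (ball 0 1)"
  unfolding has_distributional_bilaplacian_def
proof (intro conjI allI impI)
  show "locally_integrable (ball 0 1) w"
    using w_distributional_bilaplacian by (simp add: has_distributional_bilaplacian_def)
  show "locally_integrable (ball 0 1) (\<lambda>x. coeff x * exp (w x powr (1 / \<gamma>)))"
    by (rule locally_integrableI[OF rhs_integrable open_ball])
  fix \<phi> :: "real^4 \<Rightarrow> real" assume \<phi>: "test_function (ball 0 1) \<phi>"
  note m = test_function_measurable[OF \<phi>, of "ball 0 1"]
  have "(LINT x|lebesgue_on (ball 0 1). coeff x * exp (w x powr (1 / \<gamma>)) * \<phi> x)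
      = (LINT x|lebesgue_on (ball 0 1). bilaplacian w x * \<phi> x)"
    by (rule integral_cong_AE)
      (use equation_AE in \<open>auto intro!: borel_measurable_times m rhs_measurable
        borel_measurable_integrable[OF bilaplacian_w_integrable]\<close>)
  then show "(LINT x|lebesgue_on (ball 0 1). w x * bilaplacian \<phi> x)
      = (LINT x|lebesgue_on (ball 0 1). coeff x * exp (w x powr (1 / \<gamma>)) * \<phi> x)"
    using w_distributional_bilaplacian \<phi> by (simp add: has_distributional_bilaplacian_def)
qed

lemma F_0_at_top: "filterlim (F 0) at_top at_top"
proof -
  have shift: "filterlim (\<lambda>t. t + k) at_top at_top" by real_asymp
  have 1: "filterlim (\<lambda>t. g 0 (t + k)) at_top at_top"
    by (rule filterlim_compose[OF g_asymptotics(3) shift])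
  have "((\<lambda>t. - (M * exp (- t)) + C * exp (- 2 * t)) \<longlongrightarrow> 0) at_top" by real_asymp
  from filterlim_tendsto_add_at_top[OF this 1] show ?thesis
    by (simp add: F_def[abs_def] algebra_simps)
qed

text \<open>\<open>w\<close> tends to infinity at the origin, so it exceeds any given bound on a
  punctured ball, a set of positive measure.\<close>

lemma w_not_in_Linfty: "\<not> in_Linfty (ball 0 1) w"
proof
  assume "in_Linfty (ball 0 1) w"
  then obtain K where K: "AE x in lebesgue_on (ball 0 1). \<bar>w x\<bar> \<le> K"
    by (auto simp: in_Linfty_def)
  have "filterlim w at_top (at 0)"
    unfolding w_def[abs_def] by (rule filterlim_compose[OF F_0_at_top filterlim_log_depth])
  then have "eventually (\<lambda>x. w x > K) (at 0)" by (simp add: filterlim_at_top_dense)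
  then obtain d where d: "d > 0" "\<And>x. x \<noteq> 0 \<Longrightarrow> dist x 0 < d \<Longrightarrow> w x > K"
    by (auto simp: eventually_at)
  define e where "e = min d 1"
  have e: "e > 0" "ball 0 e \<subseteq> ball (0::real^4) 1" using d by (auto simp: e_def)
  have B: "ball (0::real^4) 1 \<in> sets lebesgue" by auto
  have "AE x in lebesgue_on (ball (0::real^4) 1). x \<notin> ball 0 e"
    using K AE_lebesgue_on_neq[OF B, of 0]
  proof eventually_elim
    case (elim x)
    then show ?case using d(2)[of x] by (auto simp: e_def)
  qed
  moreover have s: "ball (0::real^4) e \<in> sets (lebesgue_on (ball 0 1))"
    using e(2) B by (auto simp: sets_restrict_space_iff)
  ultimately have "ball (0::real^4) e \<in> null_sets (lebesgue_on (ball 0 1))"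
    by (simp add: AE_iff_null_sets)
  then have "emeasure (lebesgue_on (ball 0 1)) (ball (0::real^4) e) = 0" by auto
  then have "emeasure lebesgue (ball (0::real^4) e) = 0"
    using e(2) B by (subst (asm) emeasure_restrict_space) auto
  then have "measure lebesgue (ball (0::real^4) e) = 0" by (simp add: measure_def)
  then show False using content_ball_pos[OF e(1), of "0::real^4"] by simp
qed

end

theorem mainTheorem7:
  fixes \<alpha> :: real
  assumes "1 < \<alpha>" and "\<alpha> < 2"
  shows "\<exists>(\<rho>::real) (a :: real^4 \<Rightarrow> real) (w :: real^4 \<Rightarrow> real).
    \<rho> > 0 \<and>
    continuous_on (cball 0 \<rho>) a \<and> (\<forall>x\<in>cball 0 \<rho>. a x > 0) \<and>
    (\<forall>x\<in>ball 0 \<rho> - {0}. w x > 0) \<and>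
    smooth_up_to (cball 0 \<rho> - {0}) w \<and>
    (\<forall>p. 1 < p \<and> p < 4/3 \<longrightarrow> in_Sobolev 3 p (ball 0 \<rho>) w) \<and>
    (\<exists>h. integrable (lebesgue_on (ball 0 \<rho>)) h \<and>
         has_distributional_bilaplacian w h (ball 0 \<rho>)) \<and>
    integrable (lebesgue_on (ball 0 \<rho>)) (\<lambda>x. a x * exp (w x powr \<alpha>)) \<and>
    has_distributional_bilaplacian w (\<lambda>x. a x * exp (w x powr \<alpha>)) (ball 0 \<rho>) \<and>
    (\<forall>x\<in>sphere 0 \<rho>. w x = 0 \<and>
       has_normal_derivative w 0 (cball 0 \<rho>) (x /\<^sub>R \<rho>) x) \<and>
    \<not> in_Linfty (ball 0 \<rho>) w"
proof -
  have \<gamma>: "1 / 2 < 1 / \<alpha>" "1 / \<alpha> < 1" using assms by (auto simp: field_simps)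
  interpret log_profile "1 / \<alpha>" by unfold_locales (rule \<gamma>)+
  obtain k where k: "k \<ge> 2"
    "\<And>y. y \<ge> k \<Longrightarrow> 0 < g 0 y \<and> g 0 y \<le> y \<and> 0 < g 1 y \<and> 0 < 2 * g 1 y + g 2 y"
    "\<And>y. y \<ge> k \<Longrightarrow> 0 < g 4 y - 4 * g 2 y \<and> g 4 y - 4 * g 2 y \<le> (1 - 4 * a 2) * y powr (1 / \<alpha> - 2)"
    "\<And>y. y \<ge> k \<Longrightarrow> \<bar>g 1 y\<bar> \<le> 1 \<and> \<bar>g 2 y\<bar> \<le> 1 \<and> \<bar>g 3 y\<bar> \<le> 1"
    using exists_shift by blast
  interpret shifted_log_profile "1 / \<alpha>" k by unfold_locales (use k in blast)+
  show ?thesis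
  \<comment> \<open>The radius can be 1 because the shift \<open>k\<close> has already done the
    rescaling.\<close>
  proof (rule exI[of _ 1], rule exI[of _ coeff], rule exI[of _ w], intro conjI ballI allI impI, goal_cases)
    case 1
    then show ?case by simp
  next
    case 2
    then show ?case by (rule coeff_continuous)
  next
    case (3 x)
    then show ?case by (rule coeff_pos)
  next
    case (4 x)
    then show ?case using F_0_pos[OF log_depth_pos[of x]] by (simp add: w_def)
  next
    \<comment> \<open>\<open>V\<close> is the punctured ball of radius \<open>exp 1\<close>, and
      \<open>w\<close> is its own smooth extension to it.\<close>
    case 5
    then show ?case unfolding smooth_up_to_def
      using open_depth_domain smooth_w cball_subset_depth_domain[of "-1", where 'a = "real^4"]
      by (intro exI[of _ V] exI[of _ w]) auto
  next
    case (6 p)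
    then show ?case using w_in_Sobolev by simp
  next
    case 7
    then show ?case using bilaplacian_w_integrable w_distributional_bilaplacian by blast
  next
    case 8
    then show ?case using rhs_integrable by simp
  next
    case 9
    then show ?case using distributional_solution by simp
  next
    case (10 x)
    then show ?case by (simp add: w_def log_depth_def F_0_0)
  next
    case (11 x)
    then show ?case by (intro w_normal_derivative F_1_0)
  next
    case 12
    then show ?case by (rule w_not_in_Linfty)
  qed
qed

end
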